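(* Let $n\ge 2$ and suppose that $p:\mathbb{R}^n\to[1,n]$ satisfies both the log-Hölder continuity condition and the log-Hölder decay condition. Let $\delta>0$ be arbitrary and let $h$ be the gauge function given by $$h(x,t)=t^{\,n-p(x)}\Big(\log\frac1t\Big)^{-p^+-\delta}.$$ If $E\subset\mathbb{R}^n$ is any set with $C_{p(\cdot)}(E)=0$, then $\mathcal{H}^{h(\cdot)}(E)=0$.
   Context: Exponents: $p^+=\operatorname{ess\,sup}_{x\in\mathbb{R}^n}p(x)$, $p^-=\operatorname{ess\,inf}_{x\in\mathbb{R}^n}p(x)$. Log-Hölder continuity: there is $c_1>0$ with $|p(x)-p(y)|\le \dfrac{c_1}{\log(e+1/|x-y|)}$ for all $x\neq y$ in $\mathbb{R}^n$. Log-Hölder decay: there are $p_\infty\in\mathbb{R}$ and $c_2>0$ with $|p(x)-p_\infty|\le \dfrac{c_2}{\log(e+|x|)}$ for all $x\in\mathbb{R}^n$. Variable exponent spaces: $L^{p(\cdot)}(\mathbb{R}^n)$ is the space of measurable $u$ with $\int_{\mathbb{R}^n}|\lambda u(x)|^{p(x)}dx<\infty$ for some $\lambda>0$; $W^{1,p(\cdot)}(\mathbb{R}^n)$ is the space of $u\in L^{p(\cdot)}(\mathbb{R}^n)$ whose first-order weak partial derivatives exist and belong to $L^{p(\cdot)}(\mathbb{R}^n)$. Capacity: the Sobolev $p(\cdot)$-capacity of $E\subset\mathbb{R}^n$ is $$C_{p(\cdot)}(E)=\inf_{u\in S_{p(\cdot)}(E)}\int_{\mathbb{R}^n}\big(|u|^{p(x)}+|\nabla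 u|^{p(x)}\big)\,dx,$$ where $S_{p(\cdot)}(E)=\{u\in W^{1,p(\cdot)}(\mathbb{R}^n): u\ge 1 \text{ in an open set containing } E \text{ and } u\ge 0\}$. Generalized Hausdorff measure: for a gauge function $h(x,t)>0$ that is non-decreasing in $t$ with $\lim_{t\to0}h(x,t)=0$, $$\mathcal{H}^{h(\cdot)}(E)=\lim_{\eta\to0}\mathcal{H}^{h(\cdot)}_\eta(E),\qquad \mathcal{H}^{h(\cdot)}_\eta(E)=\inf\Big\{\sum_i h(x_i,\operatorname{diam}(B_i)): E\subset\bigcup_i B_i,\ 0<\operatorname{diam}(B_i)\le\eta\Big\},$$ where the infimum is over countable families of balls $B_i$ and $x_i$ is the center of $B_i$. The formula for $h$ is used for $0<t<1$; only arbitrarily small values of $t$ matter for $\mathcal{H}^{h(\cdot)}$. *)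

theory Defs
  imports "HOL-Analysis.Analysis" "HOL-Probability.Essential_Supremum"
begin

definition log_Holder_continuous :: "('a::euclidean_space \<Rightarrow> real) \<Rightarrow> bool" where
  "log_Holder_continuous p \<longleftrightarrow>
     (\<exists>c1>0. \<forall>x y. x \<noteq> y \<longrightarrow> \<bar>p x - p y\<bar> \<le> c1 / ln (exp 1 + 1 / norm (x - y)))"

definition log_Holder_decay :: "('a::euclidean_space \<Rightarrow> real) \<Rightarrow> bool" where
  "log_Holder_decay p \<longleftrightarrow>
     (\<exists>p_inf. \<exists>c2>0. \<forall>x. \<bar>p x - p_inf\<bar> \<le> c2 / ln (exp 1 + norm x))"

text \<open>The library's \<open>esssup\<close> needs a complete order, hence the detour through \<open>ereal\<close>; for a
  bounded measurable exponent the value is finite.\<close>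

definition exponent_sup :: "('a::euclidean_space \<Rightarrow> real) \<Rightarrow> real" where
  "exponent_sup p = real_of_ereal (esssup lebesgue (\<lambda>x. ereal (p x)))"

text \<open>Functions in the Lebesgue and Sobolev spaces below are represented by actual functions rather
  than by classes modulo null sets; pointwise conditions on them are therefore imposed almost
  everywhere.\<close>

definition Lp_var :: "('a::euclidean_space \<Rightarrow> real) \<Rightarrow> ('a \<Rightarrow> real) set" where
  "Lp_var p = {u \<in> borel_measurable lebesgue.
     \<exists>l>0. (\<integral>\<^sup>+x. ennreal (\<bar>l * u x\<bar> powr p x) \<partial>lebesgue) < \<infinity>}"

text \<open>\<open>k\<close> times continuously differentiable; \<open>frechet_derivative f (at x) i\<close> is the partial
  derivative of \<open>f\<close> in the coordinate direction \<open>i\<close>.\<close>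

primrec cont_diff :: "nat \<Rightarrow> ('a::euclidean_space \<Rightarrow> real) \<Rightarrow> bool" where
  "cont_diff 0 f \<longleftrightarrow> continuous_on UNIV f"
| "cont_diff (Suc k) f \<longleftrightarrow> f differentiable_on UNIV \<and>
     (\<forall>i\<in>Basis. cont_diff k (\<lambda>x. frechet_derivative f (at x) i))"

definition test_functions :: "('a::euclidean_space \<Rightarrow> real) set" where
  "test_functions = {\<phi>. (\<forall>k. cont_diff k \<phi>) \<and> compact (closure {x. \<phi> x \<noteq> 0})}"

definition locally_integrable :: "('a::euclidean_space \<Rightarrow> real) \<Rightarrow> bool" where
  "locally_integrable u \<longleftrightarrow> (\<forall>K. compact K \<longrightarrow> set_integrable lebesgue K u)"

definition weak_partial ::
    "'a::euclidean_space \<Rightarrow> ('a \<Rightarrow> real) \<Rightarrow> ('a \<Rightarrow> real) \<Rightarrow> bool" where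
  "weak_partial i u g \<longleftrightarrow> locally_integrable u \<and> locally_integrable g \<and>
     (\<forall>\<phi>\<in>test_functions.
        (LINT x|lebesgue. u x * frechet_derivative \<phi> (at x) i) = - (LINT x|lebesgue. g x * \<phi> x))"

definition weak_gradient :: "('a::euclidean_space \<Rightarrow> real) \<Rightarrow> ('a \<Rightarrow> 'a) \<Rightarrow> bool" where
  "weak_gradient u G \<longleftrightarrow> (\<forall>i\<in>Basis. weak_partial i u (\<lambda>x. G x \<bullet> i))"

definition W1p_var :: "('a::euclidean_space \<Rightarrow> real) \<Rightarrow> ('a \<Rightarrow> real) set" where
  "W1p_var p = {u \<in> Lp_var p. \<forall>i\<in>Basis. \<exists>g\<in>Lp_var p. weak_partial i u g}"

definition capacity_admissible ::
    "('a::euclidean_space \<Rightarrow> real) \<Rightarrow> 'a set \<Rightarrow> ('a \<Rightarrow> real) set" where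
  "capacity_admissible p E = {u \<in> W1p_var p.
     (\<exists>U. open U \<and> E \<subseteq> U \<and> (AE x in lebesgue. x \<in> U \<longrightarrow> 1 \<le> u x)) \<and>
     (AE x in lebesgue. 0 \<le> u x)}"

text \<open>The weak gradient \<open>G\<close> of \<open>u\<close> is unique up to null sets, so letting the infimum range over all
  representatives \<open>G\<close> has no effect on its value.\<close>

definition sobolev_capacity :: "('a::euclidean_space \<Rightarrow> real) \<Rightarrow> 'a set \<Rightarrow> ennreal" where
  "sobolev_capacity p E =
     Inf {(\<integral>\<^sup>+x. ennreal (\<bar>u x\<bar> powr p x + norm (G x) powr p x) \<partial>lebesgue) | u G.
            u \<in> capacity_admissible p E \<and> weak_gradient u G}"

text \<open>A countable, possibly finite, family of balls is indexed by a set \<open>I\<close> of natural numbers.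
  Positive diameter forces the radii to be positive.\<close>

definition hausdorff_pre ::
    "('a::euclidean_space \<Rightarrow> real \<Rightarrow> real) \<Rightarrow> real \<Rightarrow> 'a set \<Rightarrow> ennreal" where
  "hausdorff_pre h \<eta> E =
     Inf {(\<Sum>\<^sub>\<infinity>i\<in>I. ennreal (h (c i) (diameter (ball (c i) (r i))))) |
            (I :: nat set) (c :: nat \<Rightarrow> 'a) (r :: nat \<Rightarrow> real).
            E \<subseteq> (\<Union>i\<in>I. ball (c i) (r i)) \<and>
            (\<forall>i\<in>I. 0 < diameter (ball (c i) (r i)) \<and> diameter (ball (c i) (r i)) \<le> \<eta>)}"

text \<open>The limit always exists, since \<open>hausdorff_pre h \<eta> E\<close> is antimonotone in \<open>\<eta>\<close>. It depends only on
  the values \<open>h x t\<close> with \<open>t\<close> in an arbitrarily small interval \<open>{0<..<\<epsilon>}\<close>.\<close>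

definition hausdorff_gauge ::
    "('a::euclidean_space \<Rightarrow> real \<Rightarrow> real) \<Rightarrow> 'a set \<Rightarrow> ennreal" where
  "hausdorff_gauge h E = Lim (at_right 0) (\<lambda>\<eta>. hausdorff_pre h \<eta> E)"

end

theory Submission
  imports Defs "HOL-Real_Asymp.Real_Asymp"
begin

text \<open>
  Write \<open>n\<close> for the dimension and let \<open>u\<close> be admissible for \<open>E\<close> with a small modular. Around a point
  \<open>x\<close> of \<open>E\<close> consider the weighted means \<open>F r\<close> of \<open>u\<close> over \<open>ball x r\<close>, taken with a smooth bump of fixed
  mass. As \<open>u \<ge> 1\<close> near \<open>x\<close>, they stay above a constant \<open>\<kappa>\<close> for small \<open>r\<close>, while at a fixed radius
  \<open>R\<close> the small modular forces \<open>F R \<le> \<kappa> / 2\<close>. By the definition of the weak gradient \<open>G\<close>, tested with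
  the bump times the radial field, the derivative of \<open>F\<close> is a weighted integral of \<open>G\<close>
  (\<open>has_real_derivative_bump_mean\<close>), and it is bounded by \<open>r ^ (- n)\<close> times the integral of \<open>norm G\<close> over
  the ball. The function \<open>ln (1 / r) powr (- 1 - \<epsilon>) / r\<close> being integrable at \<open>0\<close>, there is a radius
  \<open>r < R\<close> at which the mean of \<open>norm G\<close> exceeds a multiple \<open>A\<close> of this function
  (\<open>exists_large_derivative\<close>).

  Such a mean can be raised to the power \<open>p x\<close>: log-Hoelder continuity makes powers of \<open>1 / r\<close> with
  exponents \<open>p x\<close> and \<open>p y\<close> comparable on the ball, so that \<open>r powr n * A powr p x\<close> is dominated by the
  integral of \<open>norm G powr p\<close> over the ball (\<open>large_mean_imp_large_modular\<close>). For
  \<open>\<epsilon> = \<delta> / n\<close> the left-hand side dominates the gauge \<open>h\<close> at the ball enlarged five times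
  (\<open>gauge_le_power\<close>), because \<open>(1 + \<epsilon>) * p x\<close> is at most the supremum of \<open>p\<close> plus \<open>\<delta>\<close>. Vitali's
  covering lemma then bounds the Hausdorff premeasure of \<open>E\<close> by a constant times the modular of \<open>u\<close>
  (\<open>hausdorff_pre_le_energy\<close>). The constant does not depend on \<open>u\<close>, and the modular can be made
  arbitrarily small when the capacity vanishes.
\<close>

section \<open>Smooth bump functions\<close>

text \<open>The family \<open>exp (- 1 / t) / t ^ k\<close>, extended by zero to the left, contains the standard smooth
  cutoff (\<open>k = 0\<close>), and the span of the family is closed under differentiation. Smoothness of a bump
  therefore never has to be discussed order by order.\<close>

definition flat :: "nat \<Rightarrow> real \<Rightarrow> real" where
  "flat k t = (if t \<le> 0 then 0 else exp (- 1 / t) / t ^ k)"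

lemma flat_nonneg: "0 \<le> flat k t"
  by (simp add: flat_def)

lemma flat_nonpos: "t \<le> 0 \<Longrightarrow> flat k t = 0"
  by (simp add: flat_def)

text \<open>With \<open>s = 1 / t\<close> this says that \<open>exp s\<close> beats every power of \<open>s\<close>. It is what makes the two
  branches of \<open>flat\<close> fit together to infinite order.\<close>

lemma tendsto_flat_0: "flat k \<midarrow>0\<rightarrow> 0"
proof (rule filterlim_split_at)
  have "eventually (\<lambda>t. flat k t = 0) (at_left 0)"
    by (auto simp: flat_def eventually_at_left_field intro!: exI[of _ "-1"])
  then show "(flat k \<longlongrightarrow> 0) (at_left 0)"
    by (rule tendsto_eventually)
  have "((\<lambda>t. inverse t ^ k / exp (inverse t)) \<longlongrightarrow> (0::real)) (at_right 0)"
    by (rule filterlim_compose[OF tendsto_power_div_exp_0 filterlim_inverse_at_top_right])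
  moreover have "eventually (\<lambda>t. inverse t ^ k / exp (inverse t) = flat k t) (at_right 0)"
    by (auto simp: eventually_at_right_field flat_def exp_minus field_simps intro!: exI[of _ 1])
  ultimately show "(flat k \<longlongrightarrow> 0) (at_right 0)"
    by (rule Lim_transform_eventually)
qed

lemma DERIV_flat: "(flat k has_real_derivative flat (k + 2) t - real k * flat (k + 1) t) (at t)"
proof (cases t "0::real" rule: linorder_cases)
  case less
  have "(flat k has_real_derivative 0) (at t)"
    by (rule has_field_derivative_transform_within[where f = "\<lambda>_. 0" and d = "-t"])
       (use less in \<open>auto simp: flat_def dist_real_def\<close>)
  then show ?thesis using less by (simp add: flat_def)
next
  case equal
  have "eventually (\<lambda>s. flat (k + 1) s = (flat k s - flat k 0) / (s - 0)) (at 0)"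
    unfolding eventually_at by (auto simp: flat_def intro!: exI[of _ 1])
  with tendsto_flat_0 have "((\<lambda>s. (flat k s - flat k 0) / (s - 0)) \<longlongrightarrow> 0) (at 0)"
    by (rule Lim_transform_eventually)
  then show ?thesis
    using equal by (simp add: has_field_derivative_iff flat_nonpos)
next
  case greater
  have "((\<lambda>t. exp (- 1 / t) * inverse t ^ k) has_real_derivative
      exp (- 1 / t) * inverse t ^ (k + 2) - real k * (exp (- 1 / t) * inverse t ^ (k + 1))) (at t)"
  proof (cases k)
    case 0
    then show ?thesis using greater
      by (auto intro!: derivative_eq_intros simp: field_simps power2_eq_square)
  next
    case (Suc m)
    then show ?thesis using greater
      by (auto intro!: derivative_eq_intros simp: field_simps power2_eq_square) (cases m; simp)+
  qed
  then have "(flat k has_real_derivative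
      exp (- 1 / t) * inverse t ^ (k + 2) - real k * (exp (- 1 / t) * inverse t ^ (k + 1))) (at t)"
    by (rule has_field_derivative_transform_within[where d = t])
       (use greater in \<open>auto simp: flat_def dist_real_def divide_inverse power_inverse\<close>)
  then show ?thesis using greater by (simp add: flat_def divide_inverse power_inverse)
qed

lemma continuous_flat: "continuous_on A (flat k)"
  by (meson DERIV_flat DERIV_isCont continuous_at_imp_continuous_on)

lemma flat_0_le_1: "flat 0 t \<le> 1"
  by (simp add: flat_def)

lemma flat_2_le_1: "flat 2 t \<le> 2"
proof (cases "t \<le> 0")
  case False
  then have "(1 / t)\<^sup>2 \<le> 2 * exp (1 / t)"
    using exp_lower_Taylor_quadratic[of "1 / t"] zero_le_divide_1_iff[of t] by linarith
  then show ?thesis using False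
    by (simp add: flat_def exp_minus field_simps)
qed (simp add: flat_def)

text \<open>Partial derivatives are \<open>P' x i\<close> for a fixed direction \<open>i\<close>; as functions of \<open>x\<close> they have to be
  polynomials again for the induction on the order of differentiability below.\<close>

lemma real_polynomial_function_gradient:
  fixes P :: "'a::euclidean_space \<Rightarrow> real"
  assumes "real_polynomial_function P"
  shows "\<exists>P'. (\<forall>i. real_polynomial_function (\<lambda>x. P' x i)) \<and> (\<forall>x. (P has_derivative P' x) (at x))"
  using assms
proof induction
  case (linear f)
  then show ?case
    by (intro exI[of _ "\<lambda>x. f"]) (auto intro: bounded_linear_imp_has_derivative)
next
  case (const c)
  then show ?case by (intro exI[of _ "\<lambda>x i. 0"]) auto
next
  case (add f g)
  then obtain f' g' where "\<And>i. real_polynomial_function (\<lambda>x. f' x i)"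
    "\<And>x. (f has_derivative f' x) (at x)" "\<And>i. real_polynomial_function (\<lambda>x. g' x i)"
    "\<And>x. (g has_derivative g' x) (at x)" by blast
  then show ?case
    by (intro exI[of _ "\<lambda>x i. f' x i + g' x i"]) (auto intro!: derivative_eq_intros)
next
  case (mult f g)
  then obtain f' g' where "\<And>i. real_polynomial_function (\<lambda>x. f' x i)"
    "\<And>x. (f has_derivative f' x) (at x)" "\<And>i. real_polynomial_function (\<lambda>x. g' x i)"
    "\<And>x. (g has_derivative g' x) (at x)" by blast
  with mult.hyps show ?case
    by (intro exI[of _ "\<lambda>x i. f x * g' x i + f' x i * g x"] conjI allI has_derivative_mult
        real_polynomial_function.intros(3,4))
qed

text \<open>Finite sums of products of a polynomial with some \<open>flat k\<close> composed with \<open>q\<close>. For polynomial \<open>q\<close>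
  the chain rule maps this class into itself.\<close>

inductive flat_combination :: "('a::euclidean_space \<Rightarrow> real) \<Rightarrow> ('a \<Rightarrow> real) \<Rightarrow> bool"
  for q :: "'a \<Rightarrow> real" where
  summand: "real_polynomial_function P \<Longrightarrow> flat_combination q (\<lambda>x. P x * flat k (q x))"
| add: "flat_combination q f \<Longrightarrow> flat_combination q g \<Longrightarrow> flat_combination q (\<lambda>x. f x + g x)"

lemma flat_combination_gradient:
  assumes q: "real_polynomial_function q" and "flat_combination q f"
  shows "\<exists>f'. (\<forall>i. flat_combination q (\<lambda>x. f' x i)) \<and> (\<forall>x. (f has_derivative f' x) (at x))"
  using assms(2)
proof induction
  case (summand P k)
  obtain P' where P': "\<And>i. real_polynomial_function (\<lambda>x. P' x i)"
    and dP: "\<And>x. (P has_derivative P' x) (at x)"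
    using real_polynomial_function_gradient[OF summand.hyps] by blast
  obtain q' where q': "\<And>i. real_polynomial_function (\<lambda>x. q' x i)"
    and dq: "\<And>x. (q has_derivative q' x) (at x)"
    using real_polynomial_function_gradient[OF q] by blast
  define f' where "f' x i = P' x i * flat k (q x) + ((P x * q' x i) * flat (k + 2) (q x)
      + (- real k * (P x * q' x i)) * flat (k + 1) (q x))" for x i
  have "flat_combination q (\<lambda>x. f' x i)" for i
    unfolding f'_def by (intro flat_combination.intros P' q' summand.hyps
        real_polynomial_function.intros(2,4))
  moreover have "((\<lambda>x. P x * flat k (q x)) has_derivative f' x) (at x)" for x
  proof -
    have "((\<lambda>x. flat k (q x)) has_derivative
        (\<lambda>i. q' x i * (flat (k + 2) (q x) - real k * flat (k + 1) (q x)))) (at x)"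
      by (rule DERIV_compose_FDERIV[OF DERIV_flat dq])
    from has_derivative_mult[OF dP this] show ?thesis
      by (rule has_derivative_eq_rhs) (auto simp: f'_def algebra_simps)
  qed
  ultimately show ?case by blast
next
  case (add f g)
  then obtain f' g' where "\<And>i. flat_combination q (\<lambda>x. f' x i)"
    "\<And>x. (f has_derivative f' x) (at x)" "\<And>i. flat_combination q (\<lambda>x. g' x i)"
    "\<And>x. (g has_derivative g' x) (at x)" by blast
  then show ?case
    by (intro exI[of _ "\<lambda>x i. f' x i + g' x i"])
       (auto intro!: derivative_eq_intros flat_combination.add)
qed

text \<open>Since the partial derivatives stay in the class, membership alone yields all orders.\<close>

lemma cont_diff_flat_combination:
  assumes q: "real_polynomial_function q"
  shows "flat_combination q f \<Longrightarrow> cont_diff k f"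
proof (induction k arbitrary: f)
  case 0
  from flat_combination_gradient[OF q 0] have "isCont f x" for x
    by (blast intro: has_derivative_continuous)
  then show ?case
    by (simp add: continuous_at_imp_continuous_on)
next
  case (Suc k)
  from flat_combination_gradient[OF q Suc.prems] obtain f'
    where f': "\<And>i. flat_combination q (\<lambda>x. f' x i)" and d: "\<And>x. (f has_derivative f' x) (at x)"
    by blast
  have "frechet_derivative f (at x) = f' x" for x
    using frechet_derivative_at[OF d] by simp
  with f' d Suc.IH show ?case
    by (auto simp: differentiable_on_def differentiable_def)
qed

text \<open>Positive exactly on \<open>ball x r\<close> and polynomial in \<open>y\<close>, so that \<open>flat k (cutoff x r y)\<close> is a smooth
  bump supported in the closed ball.\<close>

definition cutoff :: "'a::euclidean_space \<Rightarrow> real \<Rightarrow> 'a \<Rightarrow> real" where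
  "cutoff x r y = 1 - (norm (y - x))\<^sup>2 / r\<^sup>2"

lemma flat_cutoff_outside: "0 < r \<Longrightarrow> y \<notin> ball x r \<Longrightarrow> flat k (cutoff x r y) = 0"
  by (simp add: flat_def cutoff_def dist_norm norm_minus_commute power_mono)

lemma real_polynomial_function_cutoff:
  "real_polynomial_function (cutoff (x::'a::euclidean_space) r)"
proof -
  have "real_polynomial_function (\<lambda>y. \<Sum>i\<in>Basis. ((y \<bullet> i + - (x \<bullet> i)) * (y \<bullet> i + - (x \<bullet> i))))"
    by (intro real_polynomial_function_sum real_polynomial_function.intros bounded_linear_inner_left) auto
  then have "real_polynomial_function (\<lambda>y. 1 + (- 1 / r\<^sup>2) *
      (\<Sum>i\<in>Basis. ((y \<bullet> i + - (x \<bullet> i)) * (y \<bullet> i + - (x \<bullet> i)))))"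
    by (intro real_polynomial_function.intros(2-4))
  moreover have "(\<Sum>i\<in>Basis. ((y \<bullet> i + - (x \<bullet> i)) * (y \<bullet> i + - (x \<bullet> i)))) = (norm (y - x))\<^sup>2" for y
    unfolding power2_norm_eq_inner by (subst euclidean_inner) (simp add: inner_diff_left)
  then have "(\<lambda>y. 1 + (- 1 / r\<^sup>2) *
      (\<Sum>i\<in>Basis. ((y \<bullet> i + - (x \<bullet> i)) * (y \<bullet> i + - (x \<bullet> i))))) = cutoff x r"
    by (simp add: cutoff_def fun_eq_iff)
  ultimately show ?thesis by simp
qed

lemma continuous_cutoff: "continuous_on A (cutoff x r)"
  unfolding cutoff_def divide_inverse by (intro continuous_intros continuous_on_const)

lemma has_derivative_cutoff:
  "(cutoff x r has_derivative (\<lambda>v. - (2 * ((y - x) \<bullet> v)) / r\<^sup>2)) (at y)"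
  unfolding cutoff_def power2_norm_eq_inner
  by (auto intro!: derivative_eq_intros simp: inner_commute divide_inverse)

text \<open>These functions are the components of the radial field \<open>y \<mapsto> (y - x) b\<close> with \<open>b\<close> the bump. Testing the
  weak gradient against this field, whose divergence is essentially the derivative of the rescaled
  bump in its radius, replaces the Poincare inequality.\<close>

lemma coordinate_bump_test_function:
  fixes x i :: "'a::euclidean_space"
  assumes "0 < r"
  shows "(\<lambda>y. ((y - x) \<bullet> i) * flat 0 (cutoff x r y)) \<in> test_functions"
proof -
  let ?f = "\<lambda>y. ((y - x) \<bullet> i) * flat 0 (cutoff x r y)"
  have "real_polynomial_function (\<lambda>y. y \<bullet> i + - (x \<bullet> i))"
    by (intro real_polynomial_function.intros bounded_linear_inner_left)
  then have "flat_combination (cutoff x r) ?f"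
    using flat_combination.summand[of "\<lambda>y. (y - x) \<bullet> i"] by (simp add: inner_diff_left)
  moreover have "{y. ?f y \<noteq> 0} \<subseteq> cball x r"
    using flat_cutoff_outside[OF assms, of _ x 0] ball_subset_cball[of x r]
    by (metis (mono_tags, lifting) mem_Collect_eq mult_zero_right subset_eq)
  then have "bounded {y. ?f y \<noteq> 0}"
    using bounded_cball bounded_subset by blast
  ultimately show ?thesis
    unfolding test_functions_def
    by (auto intro: cont_diff_flat_combination[OF real_polynomial_function_cutoff])
qed

lemma frechet_derivative_coordinate_bump:
  fixes x i :: "'a::euclidean_space"
  assumes "i \<in> Basis"
  shows "frechet_derivative (\<lambda>y. ((y - x) \<bullet> i) * flat 0 (cutoff x r y)) (at y) i
    = flat 0 (cutoff x r y) - 2 * ((y - x) \<bullet> i)\<^sup>2 / r\<^sup>2 * flat 2 (cutoff x r y)"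
proof -
  have "((\<lambda>y. flat 0 (cutoff x r y)) has_derivative
      (\<lambda>v. (- (2 * ((y - x) \<bullet> v)) / r\<^sup>2) * flat 2 (cutoff x r y))) (at y)"
    using DERIV_compose_FDERIV[OF DERIV_flat has_derivative_cutoff, of 0] by (simp add: numeral_2_eq_2)
  then have "((\<lambda>y. ((y - x) \<bullet> i) * flat 0 (cutoff x r y)) has_derivative
     (\<lambda>v. ((y - x) \<bullet> i) * ((- (2 * ((y - x) \<bullet> v)) / r\<^sup>2) * flat 2 (cutoff x r y)) +
       (v \<bullet> i) * flat 0 (cutoff x r y))) (at y)"
    by (auto intro!: derivative_eq_intros)
  note frechet_derivative_at[OF this]
  then have "frechet_derivative
      (\<lambda>y. ((y - x) \<bullet> i) * flat 0 (cutoff x r y)) (at y) i =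
      ((y - x) \<bullet> i) * ((- (2 * ((y - x) \<bullet> i)) / r\<^sup>2) * flat 2 (cutoff x r y)) +
       (i \<bullet> i) * flat 0 (cutoff x r y)"
    by (rule subst) (rule refl)
  then show ?thesis
    using assms by (simp add: power2_eq_square)
qed

section \<open>Weighted means of weakly differentiable functions\<close>

text \<open>Differentiation under the integral sign: by the mean value theorem \<open>w\<close> also dominates the difference
  quotients.\<close>

lemma has_real_derivative_integral:
  fixes f f' :: "real \<Rightarrow> 'a \<Rightarrow> real"
  assumes r: "r \<in> {a<..<b}"
    and int: "\<And>s. s \<in> {a<..<b} \<Longrightarrow> integrable M (f s)"
    and deriv: "\<And>s y. s \<in> {a<..<b} \<Longrightarrow> ((\<lambda>s. f s y) has_real_derivative f' s y) (at s)"
    and bound: "\<And>s y. s \<in> {a<..<b} \<Longrightarrow> \<bar>f' s y\<bar> \<le> w y"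
    and meas: "f' r \<in> borel_measurable M" and w: "integrable M w"
  shows "((\<lambda>s. LINT y|M. f s y) has_real_derivative (LINT y|M. f' r y)) (at r)"
proof -
  let ?F = "\<lambda>s. LINT y|M. f s y"
  have "((\<lambda>s. (?F s - ?F r) / (s - r)) \<longlongrightarrow> (LINT y|M. f' r y)) (at r within {a<..<b})"
    unfolding tendsto_at_iff_sequentially
  proof (intro allI impI)
    fix X assume X: "\<forall>i. X i \<in> {a<..<b} - {r}" "X \<longlonglongrightarrow> r"
    have Xi: "X i \<in> {a<..<b}" "X i \<noteq> r" for i using X by auto
    define q where "q i y = (f (X i) y - f r y) / (X i - r)" for i y
    have qint: "integrable M (q i)" for i
      unfolding q_def using int[OF r] int[OF Xi(1)] by auto
    have "(\<lambda>i. LINT y|M. q i y) \<longlonglongrightarrow> (LINT y|M. f' r y)"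
    proof (rule integral_dominated_convergence[where w = w])
      show "AE y in M. (\<lambda>i. q i y) \<longlonglongrightarrow> f' r y"
      proof (rule AE_I2)
        fix y
        have "((\<lambda>s. (f s y - f r y) / (s - r)) \<longlongrightarrow> f' r y) (at r)"
          using deriv[OF r, of y] by (simp add: has_field_derivative_iff)
        moreover have "filterlim X (at r) sequentially"
          using X Xi by (auto simp: filterlim_at)
        ultimately show "(\<lambda>i. q i y) \<longlonglongrightarrow> f' r y"
          unfolding q_def by (rule filterlim_compose)
      qed
      fix i
      have "norm (q i y) \<le> w y" for y
      proof -
        have "norm (f (X i) y - f r y) \<le> w y * norm (X i - r)"
        proof (rule field_differentiable_bound[where S = "{a<..<b}" and f' = "\<lambda>s. f' s y"])
          show "((\<lambda>s. f s y) has_field_derivative f' s y) (at s within {a<..<b})"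
            if "s \<in> {a<..<b}" for s
            using deriv[OF that] by (rule has_field_derivative_at_within)
        qed (use bound Xi r in auto)
        then show ?thesis
          using Xi(2)[of i] by (simp add: q_def field_simps)
      qed
      then show "AE y in M. norm (q i y) \<le> w y" by simp
    qed (use meas w qint in auto)
    moreover have "(LINT y|M. q i y) = (?F (X i) - ?F r) / (X i - r)" for i
      unfolding q_def using int[OF r] int[OF Xi(1)] by simp
    ultimately show "((\<lambda>s. (?F s - ?F r) / (s - r)) \<circ> X) \<longlonglongrightarrow> (LINT y|M. f' r y)"
      by (simp add: o_def)
  qed
  then show ?thesis
    using r by (simp add: has_field_derivative_iff at_within_open[of r "{a<..<b}"])
qed

lemma borel_measurable_lebesgue_continuous:
  fixes g :: "'a::euclidean_space \<Rightarrow> real"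
  shows "continuous_on UNIV g \<Longrightarrow> g \<in> borel_measurable lebesgue"
  by (intro measurable_completion) (simp add: borel_measurable_continuous_onI)

lemma integrable_locally_integrable_mult:
  fixes u g :: "'a::euclidean_space \<Rightarrow> real"
  assumes u: "locally_integrable u" and g: "continuous_on UNIV g"
    and bd: "\<And>y. y \<in> ball x R \<Longrightarrow> \<bar>g y\<bar> \<le> C" and supp: "\<And>y. y \<notin> ball x R \<Longrightarrow> g y = 0"
  shows "integrable lebesgue (\<lambda>y. u y * g y)"
proof -
  have K: "integrable lebesgue (\<lambda>y. indicat_real (cball x R) y * u y)"
    using u by (simp add: locally_integrable_def set_integrable_def)
  have eq: "(\<lambda>y. u y * g y) = (\<lambda>y. indicat_real (cball x R) y * u y * g y)"
    using supp by (force simp: fun_eq_iff indicator_def)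
  note borel_measurable_integrable[OF K, measurable]
    borel_measurable_lebesgue_continuous[OF g, measurable]
  have bd': "\<bar>g y\<bar> \<le> \<bar>C\<bar>" for y
    using bd[of y] supp[of y] by (cases "y \<in> ball x R") auto
  show ?thesis unfolding eq
  proof (rule Bochner_Integration.integrable_bound)
    show "integrable lebesgue (\<lambda>y. C * (indicat_real (cball x R) y * u y))"
      using K by simp
    show "AE y in lebesgue. norm (indicat_real (cball x R) y * u y * g y)
        \<le> norm (C * (indicat_real (cball x R) y * u y))"
      using bd' by (intro AE_I2) (auto simp: abs_mult indicator_def mult.commute intro!: mult_right_mono)
  qed measurable
qed

lemma locally_integrable_imp_measurable:
  fixes u :: "'a::euclidean_space \<Rightarrow> real"
  assumes "locally_integrable u"
  shows "u \<in> borel_measurable lebesgue"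
proof (rule borel_measurable_LIMSEQ_real)
  show "(\<lambda>y. indicat_real (cball 0 (real k)) y * u y) \<in> borel_measurable lebesgue" for k
    using assms by (intro borel_measurable_integrable) (simp add: locally_integrable_def set_integrable_def)
  show "(\<lambda>k. indicat_real (cball 0 (real k)) y * u y) \<longlonglongrightarrow> u y" for y
  proof (rule tendsto_eventually)
    have "eventually (\<lambda>k. norm y \<le> real k) sequentially"
      using eventually_ge_at_top[of "nat \<lceil>norm y\<rceil>"] by eventually_elim linarith
    then show "eventually (\<lambda>k. indicat_real (cball 0 (real k)) y * u y = u y) sequentially"
      by eventually_elim simp
  qed
qed

lemma weak_gradient_imp_measurable:
  fixes G :: "'a::euclidean_space \<Rightarrow> 'a"
  assumes "weak_gradient u G"
  shows "G \<in> borel_measurable lebesgue"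
  using assms by (subst borel_measurable_euclidean_space)
    (auto simp: weak_gradient_def weak_partial_def intro: locally_integrable_imp_measurable)

lemma weak_gradient_imp_locally_integrable:
  fixes u :: "'a::euclidean_space \<Rightarrow> real"
  assumes "weak_gradient u G"
  shows "locally_integrable u"
proof -
  obtain i :: 'a where "i \<in> Basis" using nonempty_Basis by blast
  with assms show ?thesis
    by (auto simp: weak_gradient_def weak_partial_def)
qed

lemma continuous_flat_cutoff: "continuous_on A (\<lambda>y. flat k (cutoff x r y))"
  using continuous_on_compose2[OF continuous_flat continuous_cutoff] by blast

text \<open>The divergence of \<open>y \<mapsto> (y - x) b\<close> is the bracket on the left, so this is the definition of the weak
  gradient, summed over the coordinate directions. The bounds in the proof only serve to make each
  summand integrable.\<close>

lemma weak_gradient_radial_bump: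
  fixes u :: "'a::euclidean_space \<Rightarrow> real"
  assumes uG: "weak_gradient u G" and r: "0 < r"
  shows "(LINT y|lebesgue. u y * (DIM('a) * flat 0 (cutoff x r y)
            - 2 * (norm (y - x))\<^sup>2 / r\<^sup>2 * flat 2 (cutoff x r y)))
       = - (LINT y|lebesgue. (G y \<bullet> (y - x)) * flat 0 (cutoff x r y))"
proof -
  let ?b = "\<lambda>k y. flat k (cutoff x r y)"
  let ?d = "\<lambda>i y. ?b 0 y - 2 * ((y - x) \<bullet> i)\<^sup>2 / r\<^sup>2 * ?b 2 y"
  have wp: "weak_partial i u (\<lambda>y. G y \<bullet> i)" if "i \<in> Basis" for i
    using uG that by (simp add: weak_gradient_def)
  have comp: "\<bar>(y - x) \<bullet> i\<bar> \<le> r" if "y \<in> ball x r" "i \<in> Basis" for y i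
    using that Basis_le_norm[of i "y - x"] by (auto simp: dist_norm norm_minus_commute)
  have int_d: "integrable lebesgue (\<lambda>y. u y * ?d i y)" if i: "i \<in> Basis" for i
  proof (rule integrable_locally_integrable_mult[where x = x and R = r and C = "1 + 2 * 2"])
    show "locally_integrable u" using wp[OF i] by (simp add: weak_partial_def)
    show "continuous_on UNIV (?d i)"
      using r by (intro continuous_intros continuous_flat_cutoff) auto
    show "\<bar>?d i y\<bar> \<le> 1 + 2 * 2" if "y \<in> ball x r" for y
    proof -
      have "((y - x) \<bullet> i)\<^sup>2 \<le> r\<^sup>2" using comp[OF that i] by (simp add: abs_le_square_iff[symmetric])
      then have "2 * ((y - x) \<bullet> i)\<^sup>2 / r\<^sup>2 * ?b 2 y \<le> 2 * 2"
        using r by (intro mult_mono flat_2_le_1) (auto simp: flat_nonneg divide_le_eq)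
      moreover have "0 \<le> 2 * ((y - x) \<bullet> i)\<^sup>2 / r\<^sup>2 * ?b 2 y"
        by (simp add: flat_nonneg)
      ultimately show ?thesis
        using flat_nonneg[of 0 "cutoff x r y"] flat_0_le_1[of "cutoff x r y"] by linarith
    qed
    show "?d i y = 0" if "y \<notin> ball x r" for y
      using flat_cutoff_outside[OF r that] by simp
  qed
  have int_G: "integrable lebesgue (\<lambda>y. (G y \<bullet> i) * (((y - x) \<bullet> i) * ?b 0 y))" if i: "i \<in> Basis" for i
  proof (rule integrable_locally_integrable_mult[where x = x and R = r and C = r])
    show "locally_integrable (\<lambda>y. G y \<bullet> i)" using wp[OF i] by (simp add: weak_partial_def)
    show "continuous_on UNIV (\<lambda>y. ((y - x) \<bullet> i) * ?b 0 y)"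
      by (intro continuous_intros continuous_flat_cutoff)
    show "\<bar>((y - x) \<bullet> i) * ?b 0 y\<bar> \<le> r" if "y \<in> ball x r" for y
      using mult_mono[OF comp[OF that i] flat_0_le_1[of "cutoff x r y"]] r
      by (simp add: abs_mult flat_nonneg)
    show "((y - x) \<bullet> i) * ?b 0 y = 0" if "y \<notin> ball x r" for y
      using flat_cutoff_outside[OF r that] by simp
  qed
  have parts: "(LINT y|lebesgue. u y * ?d i y) = - (LINT y|lebesgue. (G y \<bullet> i) * (((y - x) \<bullet> i) * ?b 0 y))"
    if i: "i \<in> Basis" for i
    using wp[OF i] coordinate_bump_test_function[OF r, of x i]
    unfolding weak_partial_def by (auto simp: frechet_derivative_coordinate_bump[OF i])
  have "u y * (DIM('a) * ?b 0 y - 2 * (norm (y - x))\<^sup>2 / r\<^sup>2 * ?b 2 y) = (\<Sum>i\<in>Basis. u y * ?d i y)" for y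
  proof -
    have "(norm (y - x))\<^sup>2 = (\<Sum>i\<in>Basis. ((y - x) \<bullet> i)\<^sup>2)"
      unfolding power2_norm_eq_inner by (subst euclidean_inner) (simp add: power2_eq_square)
    then show ?thesis
      by (simp add: sum_subtractf sum_distrib_left[symmetric] sum_distrib_right[symmetric] sum_divide_distrib[symmetric])
  qed
  then have "(LINT y|lebesgue. u y * (DIM('a) * ?b 0 y - 2 * (norm (y - x))\<^sup>2 / r\<^sup>2 * ?b 2 y)) =
      (\<Sum>i\<in>Basis. LINT y|lebesgue. u y * ?d i y)"
    using int_d by (simp add: Bochner_Integration.integral_sum)
  also have "\<dots> = (\<Sum>i\<in>Basis. - (LINT y|lebesgue. (G y \<bullet> i) * (((y - x) \<bullet> i) * ?b 0 y)))"
    by (intro sum.cong refl parts)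
  also have "\<dots> = - (LINT y|lebesgue. (\<Sum>i\<in>Basis. (G y \<bullet> i) * (((y - x) \<bullet> i) * ?b 0 y)))"
    using int_G by (simp add: Bochner_Integration.integral_sum sum_negf)
  also have "(\<lambda>y. \<Sum>i\<in>Basis. (G y \<bullet> i) * (((y - x) \<bullet> i) * ?b 0 y)) = (\<lambda>y. (G y \<bullet> (y - x)) * ?b 0 y)"
    by (rule ext) (simp add: euclidean_inner[of "G _" "_ - x"] sum_distrib_right mult.assoc)
  finally show ?thesis .
qed

text \<open>A smooth substitute for the average of \<open>u\<close> over \<open>ball x r\<close>. The total mass of the kernel is
  independent of \<open>r\<close>, but it is not normalized to one.\<close>

definition bump_mean :: "('a::euclidean_space \<Rightarrow> real) \<Rightarrow> 'a \<Rightarrow> real \<Rightarrow> real" where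
  "bump_mean u x r = (LINT y|lebesgue. u y * (flat 0 (cutoff x r y) / r ^ DIM('a)))"

text \<open>The identity behind everything: because of the factor \<open>1 / r ^ DIM('a)\<close>, the derivative of the kernel
  in \<open>r\<close> is minus the divergence of the field \<open>(y - x) b / r ^ (DIM('a) + 1)\<close>. Changing the radius
  thus costs only the gradient.\<close>

lemma has_real_derivative_bump_mean:
  fixes u :: "'a::euclidean_space \<Rightarrow> real"
  assumes uG: "weak_gradient u G" and r: "0 < r"
  shows "(bump_mean u x has_real_derivative
      (LINT y|lebesgue. (G y \<bullet> (y - x)) * flat 0 (cutoff x r y)) / r ^ (DIM('a) + 1)) (at r)"
proof -
  let ?n = "DIM('a)"
  have u: "locally_integrable u"
    using uG by (rule weak_gradient_imp_locally_integrable)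
  define k' where "k' s y = - ((real ?n * flat 0 (cutoff x s y)
      - 2 * (norm (y - x))\<^sup>2 / s\<^sup>2 * flat 2 (cutoff x s y)) / s ^ (?n + 1))" for s y
  have deriv: "((\<lambda>s. flat 0 (cutoff x s y) / s ^ ?n) has_real_derivative k' s y) (at s)" if "0 < s" for s y
  proof -
    have "((\<lambda>s. cutoff x s y) has_real_derivative 2 * (norm (y - x))\<^sup>2 / s ^ 3) (at s)"
      unfolding cutoff_def using that
      by (auto intro!: derivative_eq_intros simp: field_simps power2_eq_square power3_eq_cube)
    from DERIV_chain2[OF DERIV_flat[of 0] this]
    have 1: "((\<lambda>s. flat 0 (cutoff x s y)) has_real_derivative
        flat 2 (cutoff x s y) * (2 * (norm (y - x))\<^sup>2 / s ^ 3)) (at s)"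
      by (simp add: numeral_2_eq_2)
    have 2: "((\<lambda>s. s ^ ?n) has_real_derivative real ?n * s ^ (?n - 1)) (at s)"
      by (rule derivative_eq_intros refl)+ simp
    have 3: "s ^ ?n = s * s ^ (?n - 1)"
      by (metis DIM_positive power_eq_if less_irrefl)
    show ?thesis
      using that by (intro DERIV_cong[OF DERIV_divide[OF 1 2]])
        (auto simp: k'_def 3 field_simps power2_eq_square power3_eq_cube)
  qed
  \<comment> \<open>Bound for the derivative of the kernel at all radii above \<open>r / 2\<close>; both \<open>flat 2\<close> and
    the factor in front of it contribute at most \<open>2\<close>.\<close>
  define M where "M = (real ?n + 2 * 2) / (r / 2) ^ (?n + 1)"
  have bound: "\<bar>k' s y\<bar> \<le> (if y \<in> cball x (2 * r) then M else 0)" if s: "s \<in> {r/2<..<2*r}" for s y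
  proof (cases "y \<in> ball x s")
    case False
    have "0 \<le> M" using r by (simp add: M_def)
    moreover have "k' s y = 0"
      using flat_cutoff_outside[OF _ False] s r by (simp add: k'_def)
    ultimately show ?thesis by simp
  next
    case True
    have s0: "0 < s" using s r by auto
    have "(norm (y - x))\<^sup>2 \<le> s\<^sup>2"
      using True by (intro power_mono) (auto simp: dist_norm norm_minus_commute)
    then have A: "2 * (norm (y - x))\<^sup>2 / s\<^sup>2 * flat 2 (cutoff x s y) \<le> 2 * 2"
      using s0 by (intro mult_mono flat_2_le_1) (simp_all add: flat_nonneg divide_le_eq)
    have B: "real ?n * flat 0 (cutoff x s y) \<le> real ?n"
      using mult_left_mono[OF flat_0_le_1[of "cutoff x s y"], of "real ?n"] by simp
    have C: "0 \<le> 2 * (norm (y - x))\<^sup>2 / s\<^sup>2 * flat 2 (cutoff x s y)" "0 \<le> real ?n * flat 0 (cutoff x s y)"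
      by (auto simp: flat_nonneg)
    have "\<bar>real ?n * flat 0 (cutoff x s y) - 2 * (norm (y - x))\<^sup>2 / s\<^sup>2 * flat 2 (cutoff x s y)\<bar> \<le> real ?n + 2 * 2"
      using A B C by linarith
    moreover have "(r / 2) ^ (?n + 1) \<le> \<bar>s ^ (?n + 1)\<bar>" "0 < (r / 2) ^ (?n + 1)"
      using s r by (auto simp del: power_Suc intro!: order_trans[OF power_mono abs_ge_self])
    ultimately have "\<bar>k' s y\<bar> \<le> M"
      unfolding k'_def M_def abs_minus_cancel abs_divide by (intro frac_le) simp_all
    then show ?thesis using True s by auto
  qed
  have kc: "continuous_on UNIV (k' s)" if "0 < s" for s
    unfolding k'_def using that by (intro continuous_intros continuous_flat_cutoff) auto
  have "((\<lambda>s. LINT y|lebesgue. u y * (flat 0 (cutoff x s y) / s ^ ?n)) has_real_derivative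
      (LINT y|lebesgue. u y * k' r y)) (at r)"
  proof (rule has_real_derivative_integral[where a = "r/2" and b = "2*r"
        and w = "\<lambda>y. M * \<bar>indicat_real (cball x (2 * r)) y * u y\<bar>"])
    fix s assume s: "s \<in> {r/2<..<2*r}"
    then have s0: "0 < s" using r by auto
    show "integrable lebesgue (\<lambda>y. u y * (flat 0 (cutoff x s y) / s ^ ?n))"
    proof (rule integrable_locally_integrable_mult[OF u, where x = x and R = s and C = "1 / s ^ ?n"])
      show "continuous_on UNIV (\<lambda>y. flat 0 (cutoff x s y) / s ^ ?n)"
        using s0 by (intro continuous_intros continuous_flat_cutoff) auto
    qed (use s0 in \<open>auto simp: flat_cutoff_outside flat_nonneg flat_0_le_1 divide_right_mono\<close>)
    show "((\<lambda>s. u y * (flat 0 (cutoff x s y) / s ^ ?n)) has_real_derivative u y * k' s y) (at s)" for y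
      by (rule DERIV_cmult[OF deriv[OF s0]])
    show "\<bar>u y * k' s y\<bar> \<le> M * \<bar>indicat_real (cball x (2 * r)) y * u y\<bar>" for y
      using mult_right_mono[OF bound[OF s, of y], of "\<bar>u y\<bar>"] by (auto simp: abs_mult mult.commute split: if_splits)
  next
    show "(\<lambda>y. u y * k' r y) \<in> borel_measurable lebesgue"
      by (intro borel_measurable_times locally_integrable_imp_measurable[OF u]
          borel_measurable_lebesgue_continuous kc r)
    show "integrable lebesgue (\<lambda>y. M * \<bar>indicat_real (cball x (2 * r)) y * u y\<bar>)"
      using u by (simp add: locally_integrable_def set_integrable_def)
  qed (use r in auto)
  moreover have "(LINT y|lebesgue. u y * k' r y) =
      (LINT y|lebesgue. (G y \<bullet> (y - x)) * flat 0 (cutoff x r y)) / r ^ (?n + 1)"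
  proof -
    have "(LINT y|lebesgue. u y * k' r y) = (LINT y|lebesgue. (- 1 / r ^ (?n + 1)) * (u y * (?n * flat 0 (cutoff x r y)
            - 2 * (norm (y - x))\<^sup>2 / r\<^sup>2 * flat 2 (cutoff x r y))))"
      by (rule Bochner_Integration.integral_cong) (auto simp: k'_def)
    also have "\<dots> = (- 1 / r ^ (?n + 1)) * (LINT y|lebesgue. (u y * (?n * flat 0 (cutoff x r y)
            - 2 * (norm (y - x))\<^sup>2 / r\<^sup>2 * flat 2 (cutoff x r y))))"
      by (rule integral_mult_right_zero)
    finally show ?thesis
      unfolding weak_gradient_radial_bump[OF uG r] by simp
  qed
  ultimately show ?thesis
    by (simp add: bump_mean_def[abs_def])
qed

lemma abs_integral_le_nn_integral:
  fixes f :: "'a \<Rightarrow> real"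
  shows "ennreal \<bar>LINT y|M. f y\<bar> \<le> (\<integral>\<^sup>+y. ennreal \<bar>f y\<bar> \<partial>M)"
  using integral_norm_bound_ennreal[of M f]
  by (cases "integrable M f") (simp_all add: not_integrable_integral_eq)

text \<open>On the support of the bump \<open>norm (y - x) \<le> r\<close>, which absorbs one power of \<open>r\<close>.\<close>

lemma norm_bump_mean_derivative_le:
  fixes u :: "'a::euclidean_space \<Rightarrow> real"
  assumes r: "0 < r" and [measurable]: "G \<in> borel_measurable lebesgue"
  shows "ennreal \<bar>(LINT y|lebesgue. (G y \<bullet> (y - x)) * flat 0 (cutoff x r y)) / r ^ (DIM('a) + 1)\<bar>
     \<le> ennreal (1 / r ^ DIM('a)) * (\<integral>\<^sup>+y. ennreal (norm (G y)) * indicator (ball x r) y \<partial>lebesgue)"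
proof -
  let ?I = "LINT y|lebesgue. (G y \<bullet> (y - x)) * flat 0 (cutoff x r y)"
  have [measurable]: "ball x r \<in> sets lebesgue" by simp
  have "ennreal \<bar>?I\<bar> \<le> (\<integral>\<^sup>+y. ennreal \<bar>(G y \<bullet> (y - x)) * flat 0 (cutoff x r y)\<bar> \<partial>lebesgue)"
    by (rule abs_integral_le_nn_integral)
  also have "\<dots> \<le> (\<integral>\<^sup>+y. ennreal r * (ennreal (norm (G y)) * indicator (ball x r) y) \<partial>lebesgue)"
  proof (rule nn_integral_mono)
    fix y
    show "ennreal \<bar>(G y \<bullet> (y - x)) * flat 0 (cutoff x r y)\<bar>
        \<le> ennreal r * (ennreal (norm (G y)) * indicator (ball x r) y)"
    proof (cases "y \<in> ball x r")
      case True
      then have "norm (y - x) \<le> r" by (simp add: dist_norm norm_minus_commute)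
      have "\<bar>G y \<bullet> (y - x)\<bar> * flat 0 (cutoff x r y) \<le> (norm (G y) * norm (y - x)) * 1"
        by (intro mult_mono Cauchy_Schwarz_ineq2) (auto simp: flat_nonneg flat_0_le_1)
      also have "\<dots> \<le> r * norm (G y)"
        using mult_left_mono[OF \<open>norm (y - x) \<le> r\<close>, of "norm (G y)"] by (simp add: mult.commute)
      finally show ?thesis using True r
        by (simp add: abs_mult flat_nonneg ennreal_mult'[symmetric] ennreal_leI)
    qed (simp add: flat_cutoff_outside[OF r])
  qed
  also have "\<dots> = ennreal r * (\<integral>\<^sup>+y. ennreal (norm (G y)) * indicator (ball x r) y \<partial>lebesgue)"
    by (rule nn_integral_cmult) measurable
  finally have "ennreal (1 / r ^ (DIM('a) + 1)) * ennreal \<bar>?I\<bar> \<le> ennreal (1 / r ^ (DIM('a) + 1)) *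
      (ennreal r * (\<integral>\<^sup>+y. ennreal (norm (G y)) * indicator (ball x r) y \<partial>lebesgue))"
    by (rule mult_left_mono) simp
  then show ?thesis
    using r by (simp add: ennreal_mult'[symmetric] mult.assoc[symmetric])
qed

section \<open>A scale with a large gradient\<close>

text \<open>If \<open>F\<close> rises from at most \<open>\<kappa> / 2\<close> at \<open>R\<close> to at least \<open>\<kappa>\<close> near \<open>0\<close>, its derivative cannot stay
  below an integrable majorant of small integral. The majorant \<open>ln (1 / r) powr (- 1 - \<epsilon>) / r\<close> has the
  primitive \<open>ln (1 / r) powr (- \<epsilon>) / \<epsilon>\<close>, which is at most \<open>1 / \<epsilon>\<close> for \<open>r \<le> exp (- 1)\<close>; this is
  where the exponent \<open>1 + \<epsilon>\<close> of the logarithm, and eventually the \<open>\<delta>\<close> in the gauge, comes from.\<close>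

lemma exists_large_derivative:
  fixes F F' :: "real \<Rightarrow> real"
  assumes der: "\<And>r. 0 < r \<Longrightarrow> (F has_real_derivative F' r) (at r)"
    and near: "eventually (\<lambda>r. \<kappa> \<le> F r) (at_right 0)"
    and R: "0 < R" "R \<le> exp (- 1)" "F R \<le> \<kappa> / 2" and pos: "0 < \<epsilon>" "0 < \<kappa>"
  shows "\<exists>r\<in>{0<..<R}. \<kappa> * \<epsilon> / 4 / r * ln (1 / r) powr (- 1 - \<epsilon>) \<le> \<bar>F' r\<bar>"
proof (rule ccontr)
  assume "\<not> ?thesis"
  then have small: "\<bar>F' r\<bar> < \<kappa> * \<epsilon> / 4 / r * ln (1 / r) powr (- 1 - \<epsilon>)" if "0 < r" "r < R" for r
    using that by force
  obtain b where b: "0 < b" "\<And>r. 0 < r \<Longrightarrow> r < b \<Longrightarrow> \<kappa> \<le> F r"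
    using near by (auto simp: eventually_at_right_field)
  define s where "s = min b R / 2"
  have s: "0 < s" "s < R" "\<kappa> \<le> F s"
    using b R by (auto simp: s_def)
  have L: "1 \<le> ln (1 / r)" if "0 < r" "r \<le> R" for r
  proof -
    have "ln r \<le> ln (exp (- 1))" using that R by (subst ln_le_cancel_iff) auto
    then show ?thesis using that by (simp add: ln_div)
  qed
  \<comment> \<open>Under the contrary assumption this perturbation of \<open>F\<close> is increasing.\<close>
  let ?H = "\<lambda>r. F r + \<kappa> / 4 * ln (1 / r) powr (- \<epsilon>)"
  have H': "(?H has_real_derivative F' r + \<kappa> * \<epsilon> / 4 / r * ln (1 / r) powr (- 1 - \<epsilon>)) (at r)"
    if "0 < r" "r \<le> R" for r
  proof -
    have "((\<lambda>r. ln (1 / r)) has_real_derivative - 1 / r) (at r)"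
      using that by (auto intro!: derivative_eq_intros simp: field_simps power2_eq_square)
    from DERIV_powr[OF this _ DERIV_const[of "- \<epsilon>"]] L[OF that]
    have "((\<lambda>r. ln (1 / r) powr (- \<epsilon>)) has_real_derivative
        ln (1 / r) powr (- \<epsilon>) * (- 1 / r * - \<epsilon> / ln (1 / r))) (at r)" by simp
    moreover have "ln (1 / r) powr (- \<epsilon>) * (- 1 / r * - \<epsilon> / ln (1 / r)) =
        \<epsilon> / r * ln (1 / r) powr (- 1 - \<epsilon>)"
    proof -
      have "ln (1 / r) powr (- 1 - \<epsilon>) = ln (1 / r) powr (- \<epsilon> + - 1)" by (simp add: algebra_simps)
      also have "\<dots> = ln (1 / r) powr (- \<epsilon>) / ln (1 / r)"
        using L[OF that] by (subst powr_add) (simp add: powr_minus_divide)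
      finally show ?thesis by simp
    qed
    ultimately have "((\<lambda>r. ln (1 / r) powr (- \<epsilon>)) has_real_derivative
        \<epsilon> / r * ln (1 / r) powr (- 1 - \<epsilon>)) (at r)" by simp
    from DERIV_add[OF der[OF that(1)] DERIV_cmult[OF this, of "\<kappa> / 4"]] show ?thesis
      by (simp add: field_simps)
  qed
  have "?H s < ?H R"
  proof (rule DERIV_pos_imp_increasing_open[OF s(2)])
    fix r assume r: "s < r" "r < R"
    then have "0 < F' r + \<kappa> * \<epsilon> / 4 / r * ln (1 / r) powr (- 1 - \<epsilon>)"
      using small[of r] s by linarith
    then show "\<exists>y. (?H has_real_derivative y) (at r) \<and> 0 < y"
      using H'[of r] r s by force
  next
    have "isCont ?H r" if "r \<in> {s..R}" for r
      using that s by (intro DERIV_isCont[OF H']) auto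
    then show "continuous_on {s..R} ?H"
      by (simp add: continuous_at_imp_continuous_on)
  qed
  moreover have "ln (1 / R) powr (- \<epsilon>) \<le> 1"
    using powr_mono[of "- \<epsilon>" 0 "ln (1 / R)"] L[of R] R pos by (simp split: if_splits)
  then have "\<kappa> / 4 * ln (1 / R) powr (- \<epsilon>) \<le> \<kappa> / 4 * 1"
    using pos by (intro mult_left_mono) auto
  moreover have "0 \<le> \<kappa> / 4 * ln (1 / s) powr (- \<epsilon>)" using pos by simp
  ultimately show False using s R pos by linarith
qed

lemma emeasure_lebesgue_ball:
  fixes x :: "'a::euclidean_space"
  assumes "0 \<le> r"
  shows "emeasure lebesgue (ball x r) = ennreal (unit_ball_vol (DIM('a)) * r ^ DIM('a))"
  using emeasure_ball[OF assms, of x] by simp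

text \<open>Once the ball lies in \<open>U\<close>, restrict to \<open>ball x (r / 2)\<close>, where the cutoff is at least \<open>1 / 2\<close> and
  hence the bump at least \<open>exp (- 2)\<close>.\<close>

lemma bump_mean_ge_near:
  fixes u :: "'a::euclidean_space \<Rightarrow> real"
  assumes u: "locally_integrable u" and nonneg: "AE y in lebesgue. 0 \<le> u y"
    and U: "open U" "x \<in> U" "AE y in lebesgue. y \<in> U \<longrightarrow> 1 \<le> u y"
  shows "eventually (\<lambda>r. exp (- 2) * unit_ball_vol (real DIM('a)) / 2 ^ DIM('a) \<le> bump_mean u x r) (at_right 0)"
proof -
  let ?n = "DIM('a)"
  obtain e where e: "0 < e" "ball x e \<subseteq> U"
    using U open_contains_ball by blast
  have "exp (- 2) * unit_ball_vol (real ?n) / 2 ^ ?n \<le> bump_mean u x r" if r: "0 < r" "r < e" for r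
  proof -
    let ?l = "\<lambda>y. exp (- 2) / r ^ ?n * indicat_real (ball x (r / 2)) y"
    have fin: "ball x (r / 2) \<in> fmeasurable lebesgue"
      by (simp add: fmeasurableI emeasure_lebesgue_ball r less_imp_le)
    have "measure lebesgue (ball x (r / 2)) = unit_ball_vol (real ?n) * (r / 2) ^ ?n"
      using r content_ball[of "r / 2" x] by simp
    then have "exp (- 2) * unit_ball_vol (real ?n) / 2 ^ ?n = (LINT y|lebesgue. ?l y)"
      using r fin by (simp add: field_simps power_divide)
    also have "\<dots> \<le> bump_mean u x r"
      unfolding bump_mean_def
    proof (rule integral_mono_AE)
      show "integrable lebesgue ?l"
        using fin by (intro integrable_mult_right) (simp add: fmeasurable_def)
      show "integrable lebesgue (\<lambda>y. u y * (flat 0 (cutoff x r y) / r ^ ?n))"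
      proof (rule integrable_locally_integrable_mult[OF u, where x = x and R = r and C = "1 / r ^ ?n"])
        show "continuous_on UNIV (\<lambda>y. flat 0 (cutoff x r y) / r ^ ?n)"
          using r by (intro continuous_intros continuous_flat_cutoff) auto
      qed (use r in \<open>auto simp: flat_cutoff_outside flat_nonneg flat_0_le_1 divide_right_mono\<close>)
      show "AE y in lebesgue. ?l y \<le> u y * (flat 0 (cutoff x r y) / r ^ ?n)"
        using nonneg U(3)
      proof eventually_elim
        case (elim y)
        show ?case
        proof (cases "y \<in> ball x (r / 2)")
          case True
          then have "1 \<le> u y" using elim e r by (auto simp: subset_eq)
          have "(norm (y - x))\<^sup>2 \<le> (r / 2)\<^sup>2"
            using True by (intro power_mono) (auto simp: dist_norm norm_minus_commute)
          then have "(norm (y - x))\<^sup>2 / r\<^sup>2 \<le> 1 / 4"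
            using r by (simp add: field_simps power2_eq_square)
          then have "1 / 2 \<le> cutoff x r y"
            unfolding cutoff_def by linarith
          then have "exp (- 2) \<le> flat 0 (cutoff x r y)"
            by (simp add: flat_def field_simps)
          then have "1 * (exp (- 2) / r ^ ?n) \<le> u y * (flat 0 (cutoff x r y) / r ^ ?n)"
            using \<open>1 \<le> u y\<close> r by (intro mult_mono divide_right_mono) (auto simp: flat_nonneg)
          then show ?thesis using True by simp
        qed (use elim r in \<open>simp add: flat_nonneg\<close>)
      qed
    qed
    finally show ?thesis .
  qed
  then show ?thesis
    using e by (auto simp: eventually_at_right_field)
qed

lemma bump_mean_le_mean:
  fixes u :: "'a::euclidean_space \<Rightarrow> real"
  assumes u: "locally_integrable u" and r: "0 < r"
  shows "ennreal (bump_mean u x r)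
     \<le> ennreal (1 / r ^ DIM('a)) * (\<integral>\<^sup>+y. ennreal \<bar>u y\<bar> * indicator (ball x r) y \<partial>lebesgue)"
proof -
  note locally_integrable_imp_measurable[OF u, measurable]
  have [measurable]: "ball x r \<in> sets lebesgue" by simp
  have "ennreal (bump_mean u x r) \<le> ennreal \<bar>bump_mean u x r\<bar>"
    by (rule ennreal_leI) simp
  also have "\<dots> \<le> (\<integral>\<^sup>+y. ennreal \<bar>u y * (flat 0 (cutoff x r y) / r ^ DIM('a))\<bar> \<partial>lebesgue)"
    unfolding bump_mean_def by (rule abs_integral_le_nn_integral)
  also have "\<dots> \<le> (\<integral>\<^sup>+y. ennreal (1 / r ^ DIM('a)) * (ennreal \<bar>u y\<bar> * indicator (ball x r) y) \<partial>lebesgue)"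
  proof (rule nn_integral_mono)
    fix y
    show "ennreal \<bar>u y * (flat 0 (cutoff x r y) / r ^ DIM('a))\<bar>
        \<le> ennreal (1 / r ^ DIM('a)) * (ennreal \<bar>u y\<bar> * indicator (ball x r) y)"
    proof (cases "y \<in> ball x r")
      case True
      have "\<bar>u y\<bar> * (flat 0 (cutoff x r y) / r ^ DIM('a)) \<le> \<bar>u y\<bar> * (1 / r ^ DIM('a))"
        using r by (intro mult_left_mono divide_right_mono flat_0_le_1) auto
      then show ?thesis using True r
        by (simp add: abs_mult flat_nonneg ennreal_mult'[symmetric] ennreal_leI mult.commute)
    qed (simp add: flat_cutoff_outside[OF r])
  qed
  also have "\<dots> = ennreal (1 / r ^ DIM('a)) * (\<integral>\<^sup>+y. ennreal \<bar>u y\<bar> * indicator (ball x r) y \<partial>lebesgue)"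
    by (rule nn_integral_cmult) measurable
  finally show ?thesis .
qed

section \<open>Comparison of means with the modular\<close>

text \<open>Either \<open>f \<le> A\<close>, or \<open>f powr (q - 1) \<ge> A powr (q - 1)\<close>. For variable exponents this plays the part
  of Jensen's inequality: the exponent \<open>q\<close> may change from point to point as long as
  \<open>A powr (1 - q)\<close> is controlled.\<close>

lemma le_truncation_plus_power:
  fixes f A q :: real
  assumes "0 \<le> f" "0 < A" "1 \<le> q"
  shows "f \<le> A + A powr (1 - q) * f powr q"
proof (cases "f \<le> A")
  case False
  have "f = f * (A powr (1 - q) * A powr (q - 1))"
    using assms by (simp flip: powr_add)
  also have "\<dots> \<le> f * (A powr (1 - q) * f powr (q - 1))"
    using False assms by (intro mult_left_mono powr_mono2) auto
  also have "\<dots> = A powr (1 - q) * (f powr 1 * f powr (q - 1))"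
    using assms by simp
  also have "\<dots> = A powr (1 - q) * f powr q"
    by (simp only: powr_add[symmetric]) simp
  finally show ?thesis using assms by simp
qed (use assms in \<open>auto intro: add_increasing2\<close>)

lemma nn_integral_ball_le_modular:
  fixes f q :: "'a::euclidean_space \<Rightarrow> real"
  assumes [measurable]: "f \<in> borel_measurable lebesgue" "q \<in> borel_measurable lebesgue"
    and f: "\<And>y. 0 \<le> f y" and "0 < A" "0 \<le> r" "0 \<le> D"
    and q: "\<And>y. y \<in> ball x r \<Longrightarrow> 1 \<le> q y" and D: "\<And>y. y \<in> ball x r \<Longrightarrow> A powr (1 - q y) \<le> D"
  shows "(\<integral>\<^sup>+y. ennreal (f y) * indicator (ball x r) y \<partial>lebesgue) \<le>
    ennreal (A * (unit_ball_vol (DIM('a)) * r ^ DIM('a))) +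
    ennreal D * (\<integral>\<^sup>+y. ennreal (f y powr q y) * indicator (ball x r) y \<partial>lebesgue)"
proof -
  have [measurable]: "ball x r \<in> sets lebesgue" by simp
  have "(\<integral>\<^sup>+y. ennreal (f y) * indicator (ball x r) y \<partial>lebesgue) \<le>
    (\<integral>\<^sup>+y. ennreal A * indicator (ball x r) y +
        ennreal D * (ennreal (f y powr q y) * indicator (ball x r) y) \<partial>lebesgue)"
  proof (rule nn_integral_mono)
    fix y
    show "ennreal (f y) * indicator (ball x r) y \<le> ennreal A * indicator (ball x r) y +
        ennreal D * (ennreal (f y powr q y) * indicator (ball x r) y)"
    proof (cases "y \<in> ball x r")
      case True
      have "f y \<le> A + A powr (1 - q y) * f y powr q y"
        using q[OF True] assms by (intro le_truncation_plus_power) auto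
      also have "\<dots> \<le> A + D * f y powr q y"
        using D[OF True] by (intro add_left_mono mult_right_mono) auto
      finally show ?thesis
        using True assms by (simp add: ennreal_mult'[symmetric] ennreal_plus[symmetric] ennreal_leI del: ennreal_plus)
    qed simp
  qed
  also have "\<dots> = ennreal A * emeasure lebesgue (ball x r) +
      ennreal D * (\<integral>\<^sup>+y. ennreal (f y powr q y) * indicator (ball x r) y \<partial>lebesgue)"
    by (simp add: nn_integral_add nn_integral_cmult nn_integral_cmult_indicator del: emeasure_completion)
  also have "ennreal A * emeasure lebesgue (ball x r) = ennreal (A * (unit_ball_vol (DIM('a)) * r ^ DIM('a)))"
    using assms by (simp add: emeasure_lebesgue_ball ennreal_mult' del: emeasure_completion)
  finally show ?thesis .
qed

text \<open>A small modular forces small means at a fixed scale: first make \<open>\<tau>\<close> small, then \<open>m\<close>.\<close>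

lemma bump_mean_le_modular:
  fixes u p :: "'a::euclidean_space \<Rightarrow> real"
  assumes u: "locally_integrable u" and p[measurable]: "p \<in> borel_measurable lebesgue"
    and pb: "\<And>y. 1 \<le> p y \<and> p y \<le> N"
    and R: "0 < R" and \<tau>: "0 < \<tau>" "\<tau> \<le> 1" and m: "0 \<le> m"
    and modular: "(\<integral>\<^sup>+y. ennreal (\<bar>u y\<bar> powr p y) \<partial>lebesgue) \<le> ennreal m"
  shows "bump_mean u x R \<le> \<tau> * unit_ball_vol (DIM('a)) + \<tau> powr (1 - N) * m / R ^ DIM('a)"
proof -
  let ?V = "unit_ball_vol (DIM('a)) * R ^ DIM('a)"
  note locally_integrable_imp_measurable[OF u, measurable]
  have "ennreal (bump_mean u x R) \<le> ennreal (1 / R ^ DIM('a)) *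
      (\<integral>\<^sup>+y. ennreal \<bar>u y\<bar> * indicator (ball x R) y \<partial>lebesgue)"
    by (rule bump_mean_le_mean[OF u R])
  also have "\<dots> \<le> ennreal (1 / R ^ DIM('a)) * (ennreal (\<tau> * ?V) +
      ennreal (\<tau> powr (1 - N)) * (\<integral>\<^sup>+y. ennreal (\<bar>u y\<bar> powr p y) * indicator (ball x R) y \<partial>lebesgue))"
    using \<tau> R pb by (intro mult_left_mono nn_integral_ball_le_modular powr_mono') auto
  also have "\<dots> \<le> ennreal (1 / R ^ DIM('a)) * (ennreal (\<tau> * ?V) + ennreal (\<tau> powr (1 - N)) * ennreal m)"
    by (intro mult_left_mono add_left_mono order_trans[OF nn_integral_mono modular])
      (auto simp: indicator_def)
  also have "\<dots> = ennreal (1 / R ^ DIM('a) * (\<tau> * ?V + \<tau> powr (1 - N) * m))"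
    using \<tau> R m by (simp add: ennreal_mult'[symmetric] ennreal_plus[symmetric] del: ennreal_plus)
  also have "1 / R ^ DIM('a) * (\<tau> * ?V + \<tau> powr (1 - N) * m) =
      \<tau> * unit_ball_vol (DIM('a)) + \<tau> powr (1 - N) * m / R ^ DIM('a)"
    using R by (simp add: field_simps)
  finally show ?thesis
    using \<tau> R m by (subst (asm) ennreal_le_iff) auto
qed

section \<open>Log-Hoelder continuity of the exponent\<close>

lemma log_Holder_imp_continuous:
  fixes p :: "'a::euclidean_space \<Rightarrow> real"
  assumes "log_Holder_continuous p"
  shows "continuous_on UNIV p"
proof -
  obtain c where c: "c > 0"
    "\<And>x y. x \<noteq> y \<Longrightarrow> \<bar>p x - p y\<bar> \<le> c / ln (exp 1 + 1 / norm (x - y))"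
    using assms unfolding log_Holder_continuous_def by blast
  have "(p \<longlongrightarrow> p x) (at x)" for x
  proof (rule LIM_zero_cancel, rule Lim_null_comparison)
    show "eventually (\<lambda>y. norm (p y - p x) \<le> c / ln (exp 1 + 1 / norm (y - x))) (at x)"
      using c(2) by (auto simp: eventually_at intro!: exI[of _ 1])
    have "((\<lambda>t. c / ln (exp 1 + 1 / t)) \<longlongrightarrow> 0) (at_right (0::real))"
      by real_asymp
    moreover have "filterlim (\<lambda>y. norm (y - x)) (at_right 0) (at x)"
      unfolding filterlim_at
      by (auto simp: eventually_at intro!: exI[of _ 1] tendsto_norm_zero LIM_zero)
    ultimately show "((\<lambda>y. c / ln (exp 1 + 1 / norm (y - x))) \<longlongrightarrow> 0) (at x)"
      by (rule filterlim_compose)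
  qed
  then show ?thesis
    by (simp add: continuous_at_imp_continuous_on isCont_def)
qed

text \<open>On a ball of radius \<open>r\<close> the oscillation of \<open>p\<close> is at most \<open>c / ln (1 / r)\<close>, so that
  \<open>(1 / r) powr (p x - p y)\<close> stays below the constant \<open>exp c\<close>.\<close>

lemma log_Holder_oscillation:
  fixes p :: "'a::euclidean_space \<Rightarrow> real"
  assumes "log_Holder_continuous p"
  obtains c where "c > 0"
    "\<And>x y r. 0 < r \<Longrightarrow> r < 1 \<Longrightarrow> y \<in> ball x r \<Longrightarrow> \<bar>p x - p y\<bar> \<le> c / ln (1 / r)"
proof -
  obtain c where c: "c > 0"
    "\<And>x y. x \<noteq> y \<Longrightarrow> \<bar>p x - p y\<bar> \<le> c / ln (exp 1 + 1 / norm (x - y))"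
    using assms unfolding log_Holder_continuous_def by blast
  have "\<bar>p x - p y\<bar> \<le> c / ln (1 / r)" if r: "0 < r" "r < 1" "y \<in> ball x r" for x y r
  proof (cases "x = y")
    case True
    then show ?thesis using c r by simp
  next
    case False
    have "1 / r \<le> 1 / norm (x - y)"
      using r False by (intro divide_left_mono) (auto simp: dist_norm)
    then have "1 / r \<le> exp 1 + 1 / norm (x - y)"
      using exp_gt_zero[of "1::real"] by linarith
    then have "ln (1 / r) \<le> ln (exp 1 + 1 / norm (x - y))"
      using r by (intro ln_mono) (auto intro: add_pos_nonneg)
    moreover have "0 < ln (1 / r)" using r by simp
    ultimately have "c / ln (exp 1 + 1 / norm (x - y)) \<le> c / ln (1 / r)"
      using c by (intro divide_left_mono) auto
    with c(2)[OF False] show ?thesis by linarith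
  qed
  with c show thesis by (intro that[of c])
qed

text \<open>The essential supremum of a continuous function bounds it everywhere, since nonempty open sets
  are not null. The upper bound \<open>M\<close> keeps the essential supremum finite, so that its conversion to a
  real number is faithful.\<close>

lemma le_exponent_sup:
  fixes p :: "'a::euclidean_space \<Rightarrow> real"
  assumes cont: "continuous_on UNIV p" and bd: "\<And>y. p y \<le> M"
  shows "p x \<le> exponent_sup p"
proof -
  let ?s = "esssup lebesgue (\<lambda>y. ereal (p y))"
  let ?S = "{y. ?s < ereal (p y)}"
  have [measurable]: "p \<in> borel_measurable lebesgue"
    by (rule borel_measurable_lebesgue_continuous[OF cont])
  have "open ?S"
    using cont by (intro open_Collect_less continuous_intros) auto
  moreover have "?S \<in> null_sets lebesgue"
    using esssup_zero_measure[of lebesgue "\<lambda>y. ereal (p y)"] \<open>open ?S\<close> by auto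
  ultimately have "?S = {}"
    using open_not_negligible negligible_iff_null_sets by blast
  then have "ereal (p x) \<le> ?s" by (auto simp: not_less)
  moreover have "?s \<le> ereal M"
    by (intro esssup_I) (auto simp: bd)
  ultimately show ?thesis
    unfolding exponent_sup_def by (cases ?s) auto
qed

text \<open>Apply the truncation inequality with \<open>A\<close> at most half the mean of \<open>f\<close>: the part below \<open>A\<close> accounts for
  at most half of the integral, and for the rest \<open>1 \<le> A \<le> 1 / r\<close> and the oscillation bound allow \<open>p y\<close> to be
  replaced by \<open>p x\<close> at the cost of the factor \<open>exp c\<close>.\<close>

lemma large_mean_imp_large_modular:
  fixes f p :: "'a::euclidean_space \<Rightarrow> real"
  assumes [measurable]: "f \<in> borel_measurable lebesgue" "p \<in> borel_measurable lebesgue"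
    and f: "\<And>y. 0 \<le> f y" and p: "\<And>y. 1 \<le> p y"
    and r: "0 < r" "r < 1" and A: "1 \<le> A" "A \<le> 1 / r"
    and osc: "\<And>y. y \<in> ball x r \<Longrightarrow> \<bar>p x - p y\<bar> \<le> c / ln (1 / r)" and c: "0 < c"
    and big: "ennreal (2 * (A * (unit_ball_vol (DIM('a)) * r ^ DIM('a))))
        \<le> (\<integral>\<^sup>+y. ennreal (f y) * indicator (ball x r) y \<partial>lebesgue)"
  shows "ennreal (unit_ball_vol (DIM('a)) * r ^ DIM('a) * A powr p x)
     \<le> ennreal (exp c) * (\<integral>\<^sup>+y. ennreal (f y powr p y) * indicator (ball x r) y \<partial>lebesgue)"
proof -
  let ?V = "unit_ball_vol (DIM('a)) * r ^ DIM('a)"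
  let ?I = "\<integral>\<^sup>+y. ennreal (f y powr p y) * indicator (ball x r) y \<partial>lebesgue"
  define D where "D = exp c * A powr (1 - p x)"
  have "A powr (1 - p y) \<le> D" if y: "y \<in> ball x r" for y
  proof -
    have L: "0 < ln (1 / r)" using r by simp
    have "A powr (p x - p y) \<le> A powr (c / ln (1 / r))"
      using osc[OF y] A by (intro powr_mono) auto
    also have "\<dots> \<le> (1 / r) powr (c / ln (1 / r))"
      using A c L by (intro powr_mono2) auto
    also have "\<dots> = exp (c / ln (1 / r) * ln (1 / r))"
      using r by (subst powr_def) simp
    also have "\<dots> = exp c" using L by simp
    finally have "A powr (p x - p y) * A powr (1 - p x) \<le> D"
      unfolding D_def by (intro mult_right_mono) auto
    then show ?thesis by (simp add: powr_add[symmetric])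
  qed
  then have split: "ennreal (2 * (A * ?V)) \<le> ennreal (A * ?V) + ennreal D * ?I"
    using assms by (intro order_trans[OF big] nn_integral_ball_le_modular) (auto simp: D_def)
  show ?thesis
  proof (cases ?I)
    case (real i)
    have "0 \<le> A * ?V" "0 \<le> D" using r A by (auto simp: D_def)
    from split have "2 * (A * ?V) \<le> A * ?V + D * i"
      unfolding real(2) using real(1) \<open>0 \<le> A * ?V\<close> \<open>0 \<le> D\<close>
      by (simp add: ennreal_mult'[symmetric] ennreal_plus[symmetric] del: ennreal_plus)
    then have "(A * ?V) * A powr (p x - 1) \<le> (D * i) * A powr (p x - 1)"
      by (intro mult_right_mono) auto
    moreover have "A * A powr (p x - 1) = A powr p x"
      using A powr_add[of A 1 "p x - 1"] by simp
    then have "(A * ?V) * A powr (p x - 1) = ?V * A powr p x"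
      by (metis mult.assoc mult.commute)
    moreover have "A powr (1 - p x) * A powr (p x - 1) = 1"
      using A by (simp flip: powr_add)
    then have "(D * i) * A powr (p x - 1) = exp c * i"
      unfolding D_def by (metis mult.assoc mult.commute mult.right_neutral)
    ultimately have "?V * A powr p x \<le> exp c * i" by simp
    then show ?thesis
      unfolding real(2) using real(1) by (simp add: ennreal_mult'[symmetric] ennreal_leI)
  next
    case top
    then show ?thesis by (simp add: ennreal_mult_top)
  qed
qed

section \<open>Covering by good balls\<close>

text \<open>The gauge at the enlarged ball against the power of the gradient threshold. The logarithms match
  because \<open>(1 + \<epsilon>) * q \<le> P + \<delta>\<close>, which uses \<open>q \<le> P\<close> and \<open>\<epsilon> * q \<le> \<delta>\<close>. The bound \<open>r \<le> 1 / 100\<close> ensures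
  \<open>ln (1 / (10 * r)) \<ge> ln (1 / r) / 2\<close>.\<close>

lemma gauge_le_power:
  fixes n q r a P \<delta> \<epsilon> :: real
  assumes r: "0 < r" "r \<le> 1 / 100" and q: "1 \<le> q" "q \<le> n" "q \<le> P"
    and a: "0 < a" "a \<le> 1" and \<epsilon>: "0 < \<epsilon>" "\<epsilon> * n \<le> \<delta>"
  shows "(10 * r) powr (n - q) * ln (1 / (10 * r)) powr (- P - \<delta>)
    \<le> 10 powr n * 2 powr (P + \<delta>) * a powr (- n) *
      (r powr n * (a / r * ln (1 / r) powr (- 1 - \<epsilon>)) powr q)"
proof -
  have "0 \<le> \<epsilon> * n" using q \<epsilon> by simp
  with \<epsilon> have \<delta>: "0 \<le> \<delta>" by linarith
  define L where "L = ln (1 / r)"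
  have "ln 100 \<le> L"
    unfolding L_def using r by (intro ln_mono) (auto simp: field_simps)
  moreover have "ln (100::real) = 2 * ln 10"
    using ln_realpow[of 10 2] by simp
  moreover have "1 \<le> ln (10::real)"
  proof -
    have "exp 1 \<le> (10::real)" using exp_le by linarith
    then show ?thesis using ln_ge_iff[of 10 1] by simp
  qed
  ultimately have L: "1 \<le> L" "ln 10 \<le> L / 2" by linarith+
  have "ln (1 / (10 * r)) = L - ln 10"
    unfolding L_def using r by (simp add: ln_div ln_mult)
  then have "ln (1 / (10 * r)) powr (- P - \<delta>) \<le> (L / 2) powr (- P - \<delta>)"
    using L q \<delta> r by (intro powr_mono2') auto
  also have "\<dots> = L powr (- P - \<delta>) / 2 powr (- (P + \<delta>))"
    using L by (simp add: powr_divide)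
  also have "\<dots> = 2 powr (P + \<delta>) * L powr (- P - \<delta>)"
    unfolding powr_minus by (simp add: divide_inverse mult.commute)
  also have "\<dots> \<le> 2 powr (P + \<delta>) * L powr ((- 1 - \<epsilon>) * q)"
  proof (intro mult_left_mono powr_mono)
    have "\<epsilon> * q \<le> \<epsilon> * n" using \<epsilon> q by (intro mult_left_mono) auto
    then have "\<epsilon> * q \<le> \<delta>" using \<epsilon>(2) by (rule order_trans)
    with q \<epsilon> show "- P - \<delta> \<le> (- 1 - \<epsilon>) * q" by (simp add: algebra_simps)
  qed (use L in auto)
  finally have 1: "ln (1 / (10 * r)) powr (- P - \<delta>) \<le> 2 powr (P + \<delta>) * L powr ((- 1 - \<epsilon>) * q)" .
  have "(10 * r) powr (n - q) = 10 powr (n - q) * r powr (n - q)"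
    using r by (simp add: powr_mult)
  also have "\<dots> \<le> 10 powr n * r powr (n - q)"
    using q by (intro mult_right_mono powr_mono) auto
  finally have 2: "(10 * r) powr (n - q) \<le> 10 powr n * r powr (n - q)" .
  have 4: "L powr ((- 1 - \<epsilon>) * q) = (L powr (- 1 - \<epsilon>)) powr q"
    by (simp only: powr_powr)
  have 5: "r powr (n - q) = r powr n * r powr (- q)"
    by (simp flip: powr_add)
  have 3: "1 \<le> a powr (- n) * a powr q"
    using a q powr_mono'[of "q - n" 0 a] by (simp flip: powr_add)
  have "(10 * r) powr (n - q) * ln (1 / (10 * r)) powr (- P - \<delta>) \<le>
      (10 powr n * r powr (n - q)) * (2 powr (P + \<delta>) * L powr ((- 1 - \<epsilon>) * q))"
    by (intro mult_mono 1 2) auto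
  also have "\<dots> \<le> (10 powr n * r powr (n - q)) * (2 powr (P + \<delta>) * L powr ((- 1 - \<epsilon>) * q)) *
      (a powr (- n) * a powr q)"
    using mult_left_mono[OF 3, of "(10 powr n * r powr (n - q)) * (2 powr (P + \<delta>) * L powr ((- 1 - \<epsilon>) * q))"]
    by simp
  also have "\<dots> = 10 powr n * 2 powr (P + \<delta>) * a powr (- n) *
      (r powr n * (a powr q * r powr (- q) * (L powr (- 1 - \<epsilon>)) powr q))"
    unfolding 4 5 by (simp only: mult_ac)
  also have "a powr q * r powr (- q) * (L powr (- 1 - \<epsilon>)) powr q = (a / r * L powr (- 1 - \<epsilon>)) powr q"
    using a r by (simp add: powr_mult powr_divide powr_minus_divide del: powr_powr)
  finally show ?thesis unfolding L_def .
qed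

text \<open>Vitali's lemma selects countably many disjoint balls whose fivefold enlargements, of diameter
  \<open>10 * r\<close>, still cover \<open>E\<close>; disjointness lets the local energies add up to at most the total one.\<close>

lemma hausdorff_pre_le_energy:
  fixes E :: "'a::euclidean_space set" and g :: "'a \<Rightarrow> ennreal"
  assumes [measurable]: "g \<in> borel_measurable lebesgue" and "0 < \<eta>"
    and ball: "\<And>x. x \<in> E \<Longrightarrow> \<exists>r. 0 < r \<and> 10 * r \<le> \<eta> \<and>
      ennreal (h x (10 * r)) \<le> K * (\<integral>\<^sup>+y. g y * indicator (ball x r) y \<partial>lebesgue)"
  shows "hausdorff_pre h \<eta> E \<le> K * (\<integral>\<^sup>+y. g y \<partial>lebesgue)"
proof -
  obtain r where r: "\<And>x. x \<in> E \<Longrightarrow> 0 < r x" "\<And>x. x \<in> E \<Longrightarrow> 10 * r x \<le> \<eta>"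
    "\<And>x. x \<in> E \<Longrightarrow> ennreal (h x (10 * r x)) \<le> K * (\<integral>\<^sup>+y. g y * indicator (ball x (r x)) y \<partial>lebesgue)"
    using ball by metis
  have "E \<subseteq> (\<Union>x\<in>E. ball x (r x))" using r(1) by fastforce
  moreover have "0 < r x \<and> r x \<le> \<eta> / 10" if "x \<in> E" for x using r that by force
  ultimately obtain C where C: "countable C" "C \<subseteq> E"
    "pairwise (\<lambda>i j. disjnt (ball i (r i)) (ball j (r j))) C"
    "E \<subseteq> (\<Union>i\<in>C. ball i (5 * r i))"
    by (rule Vitali_covering_lemma_balls)
  have inj: "inj_on (to_nat_on C) C" using C(1) by (rule inj_on_to_nat_on)
  let ?I = "to_nat_on C ` C"
  let ?c = "from_nat_into C"
  have c: "?c (to_nat_on C x) = x" if "x \<in> C" for x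
    using C(1) that by simp
  have "hausdorff_pre h \<eta> E \<le> (\<Sum>\<^sub>\<infinity>i\<in>?I. ennreal (h (?c i) (diameter (ball (?c i) (5 * r (?c i))))))"
    unfolding hausdorff_pre_def
  proof (rule Inf_lower, rule CollectI, intro exI conjI)
    show "E \<subseteq> (\<Union>i\<in>?I. ball (?c i) (5 * r (?c i)))"
      using C(4) c by auto
    show "\<forall>i\<in>?I. 0 < diameter (ball (?c i) (5 * r (?c i))) \<and> diameter (ball (?c i) (5 * r (?c i))) \<le> \<eta>"
      using c C(2) r(1,2) by (force simp: not_less)
  qed (rule refl)
  also have "\<dots> = (\<Sum>\<^sub>\<infinity>x\<in>C. ennreal (h x (10 * r x)))"
    unfolding infsum_reindex[OF inj] using c C(2) r(1)
    by (intro infsum_cong) (force simp: not_less)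
  also have "\<dots> \<le> K * (\<integral>\<^sup>+y. g y \<partial>lebesgue)"
  proof (rule infsum_le_finite_sums)
    fix F assume F: "finite F" "F \<subseteq> C"
    have disj: "disjoint_family_on (\<lambda>x. ball x (r x)) F"
      using C(3) F(2) by (auto simp: disjoint_family_on_def pairwise_def disjnt_def subset_iff)
    have [measurable]: "ball x (r x) \<in> sets lebesgue" for x by simp
    have "(\<Sum>x\<in>F. ennreal (h x (10 * r x))) \<le>
        (\<Sum>x\<in>F. K * (\<integral>\<^sup>+y. g y * indicator (ball x (r x)) y \<partial>lebesgue))"
      using F C(2) by (intro sum_mono r(3)) auto
    also have "\<dots> = K * (\<integral>\<^sup>+y. (\<Sum>x\<in>F. g y * indicator (ball x (r x)) y) \<partial>lebesgue)"
      by (simp add: sum_distrib_left nn_integral_sum)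
    also have "\<dots> \<le> K * (\<integral>\<^sup>+y. g y \<partial>lebesgue)"
    proof (intro mult_left_mono nn_integral_mono)
      fix y
      have "(\<Sum>x\<in>F. g y * indicator (ball x (r x)) y) = g y * indicator (\<Union>x\<in>F. ball x (r x)) y"
        by (simp add: indicator_UN_disjoint[OF F(1) disj] sum_distrib_left)
      also have "\<dots> \<le> g y" by (simp add: indicator_def)
      finally show "(\<Sum>x\<in>F. g y * indicator (ball x (r x)) y) \<le> g y" .
    qed simp
    finally show "(\<Sum>x\<in>F. ennreal (h x (10 * r x))) \<le> K * (\<integral>\<^sup>+y. g y \<partial>lebesgue)" .
  qed (simp add: nonneg_summable_on_complete)
  finally show ?thesis .
qed

text \<open>All constants, including the radius \<open>R\<close>, are fixed before the admissible function is chosen;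
  hence the estimate holds for every sufficiently small modular \<open>m\<close> with the same constant.\<close>

lemma hausdorff_pre_eq_0_if_capacity_0:
  fixes p :: "'a::euclidean_space \<Rightarrow> real" and h :: "'a \<Rightarrow> real \<Rightarrow> real"
  assumes p: "\<And>x. 1 \<le> p x \<and> p x \<le> real DIM('a)" and log: "log_Holder_continuous p"
    and \<delta>: "0 < \<delta>" and \<eta>: "0 < \<eta>"
    and h: "\<And>x t. 0 < t \<Longrightarrow> t < 1 \<Longrightarrow>
           h x t = t powr (real DIM('a) - p x) * ln (1 / t) powr (- exponent_sup p - \<delta>)"
    and cap: "sobolev_capacity p E = 0"
  shows "hausdorff_pre h \<eta> E = 0"
proof -
  define n where "n = real DIM('a)"
  define P where "P = exponent_sup p"
  define \<omega> where "\<omega> = unit_ball_vol n"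
  define \<kappa> where "\<kappa> = exp (- 2) * \<omega> / 2 ^ DIM('a)"
  define \<epsilon> where "\<epsilon> = \<delta> / n"
  \<comment> \<open>The second entry makes \<open>2 * \<omega> * a\<close> at most the constant \<open>\<kappa> * \<epsilon> / 4\<close> gained from the derivative,
    and \<open>a \<le> 1\<close> makes the threshold \<open>A\<close> below at most \<open>1 / r\<close>.\<close>
  define a where "a = min 1 (\<kappa> * \<epsilon> / (8 * \<omega>))"
  have n: "0 < n" by (simp add: n_def)
  have \<omega>: "0 < \<omega>" unfolding \<omega>_def using n by simp
  have \<kappa>: "0 < \<kappa>" using \<omega> by (simp add: \<kappa>_def)
  have \<epsilon>: "0 < \<epsilon>" "\<epsilon> * n = \<delta>" using \<delta> n by (simp_all add: \<epsilon>_def)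
  have a: "0 < a" "a \<le> 1" "a \<le> \<kappa> * \<epsilon> / (8 * \<omega>)" using \<kappa> \<epsilon> \<omega> by (auto simp: a_def)
  have cont: "continuous_on UNIV p" by (rule log_Holder_imp_continuous[OF log])
  note p_meas[measurable] = borel_measurable_lebesgue_continuous[OF cont]
  have pP: "p x \<le> P" for x
    unfolding P_def using p by (intro le_exponent_sup[OF cont]) blast
  obtain c where c: "0 < c"
    "\<And>x y r. 0 < r \<Longrightarrow> r < 1 \<Longrightarrow> y \<in> ball x r \<Longrightarrow> \<bar>p x - p y\<bar> \<le> c / ln (1 / r)"
    using log_Holder_oscillation[OF log] by metis
  have "filterlim (\<lambda>r. a / r * ln (1 / r) powr (- 1 - \<epsilon>)) at_top (at_right 0)"
    using a \<epsilon> by real_asymp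
  then have "eventually (\<lambda>r. 1 \<le> a / r * ln (1 / r) powr (- 1 - \<epsilon>)) (at_right 0)"
    by (simp add: filterlim_at_top)
  then obtain b where b: "0 < b" "\<And>r. 0 < r \<Longrightarrow> r < b \<Longrightarrow> 1 \<le> a / r * ln (1 / r) powr (- 1 - \<epsilon>)"
    by (auto simp: eventually_at_right_field)
  \<comment> \<open>The four bounds are for the admissible diameters, for comparing the gauge at \<open>10 * r\<close> and \<open>r\<close>,
    for the primitive in \<open>exists_large_derivative\<close>, and for \<open>A \<ge> 1\<close>.\<close>
  define R where "R = min (min (\<eta> / 10) (1 / 100)) (min (exp (- 1)) b)"
  have R: "0 < R" "10 * R \<le> \<eta>" "R \<le> 1 / 100" "R \<le> exp (- 1)" "R \<le> b"
    using \<eta> b by (auto simp: R_def)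
  define \<tau> where "\<tau> = min 1 (\<kappa> / (4 * \<omega>))"
  have \<tau>: "0 < \<tau>" "\<tau> \<le> 1" "\<tau> * \<omega> \<le> \<kappa> / 4"
    using \<kappa> \<omega> by (auto simp: \<tau>_def min_def field_simps)
  \<comment> \<open>Chosen so that \<open>\<tau> powr (1 - n) * m\<^sub>0 / R ^ DIM('a)\<close> equals \<open>\<kappa> / 4\<close>.\<close>
  define m\<^sub>0 where "m\<^sub>0 = \<kappa> / 4 * R ^ DIM('a) * \<tau> powr (n - 1)"
  have m\<^sub>0: "0 < m\<^sub>0" using \<kappa> R \<tau> by (simp add: m\<^sub>0_def)
  define K where "K = 10 powr n * 2 powr (P + \<delta>) * a powr (- n)"
  have K: "0 < K" using a by (simp add: K_def)
  have main: "hausdorff_pre h \<eta> E \<le> ennreal (K / \<omega> * exp c * m)" if m: "0 < m" "m \<le> m\<^sub>0" for m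
  proof -
    have "sobolev_capacity p E < ennreal m" using cap m by simp
    then obtain u G where uE: "u \<in> capacity_admissible p E" and uG: "weak_gradient u G"
      and mod: "(\<integral>\<^sup>+x. ennreal (\<bar>u x\<bar> powr p x + norm (G x) powr p x) \<partial>lebesgue) < ennreal m"
      unfolding sobolev_capacity_def Inf_less_iff by blast
    obtain U where U: "open U" "E \<subseteq> U" "AE x in lebesgue. x \<in> U \<longrightarrow> 1 \<le> u x"
      and u0: "AE x in lebesgue. 0 \<le> u x"
      using uE unfolding capacity_admissible_def by blast
    have u: "locally_integrable u" by (rule weak_gradient_imp_locally_integrable[OF uG])
    have [measurable]: "G \<in> borel_measurable lebesgue" by (rule weak_gradient_imp_measurable[OF uG])
    have mod_u: "(\<integral>\<^sup>+x. ennreal (\<bar>u x\<bar> powr p x) \<partial>lebesgue) \<le> ennreal m\<^sub>0"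
      by (rule order_trans[OF nn_integral_mono order_trans[OF less_imp_le[OF mod]]])
        (use m in \<open>auto intro: ennreal_leI\<close>)
    have mod_G: "(\<integral>\<^sup>+x. ennreal (norm (G x) powr p x) \<partial>lebesgue) \<le> ennreal m"
      by (rule order_trans[OF nn_integral_mono less_imp_le[OF mod]]) (auto intro: ennreal_leI)
    have "hausdorff_pre h \<eta> E \<le> ennreal (K / \<omega> * exp c) *
        (\<integral>\<^sup>+y. ennreal (norm (G y) powr p y) \<partial>lebesgue)"
    proof (rule hausdorff_pre_le_energy)
      fix x assume x: "x \<in> E"
      let ?F' = "\<lambda>r. (LINT y|lebesgue. (G y \<bullet> (y - x)) * flat 0 (cutoff x r y)) / r ^ (DIM('a) + 1)"
      have "bump_mean u x R \<le> \<tau> * unit_ball_vol (DIM('a)) + \<tau> powr (1 - n) * m\<^sub>0 / R ^ DIM('a)"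
        using p m\<^sub>0 R \<tau> by (intro bump_mean_le_modular[OF u p_meas _ _ _ _ _ mod_u]) (auto simp: n_def)
      also have "\<tau> powr (1 - n) * m\<^sub>0 / R ^ DIM('a) = \<kappa> / 4 * (\<tau> powr (1 - n) * \<tau> powr (n - 1))"
        unfolding m\<^sub>0_def using R by simp
      also have "\<tau> powr (1 - n) * \<tau> powr (n - 1) = 1"
        using \<tau> by (simp flip: powr_add)
      finally have FR: "bump_mean u x R \<le> \<kappa> / 2"
        using \<tau> by (simp add: \<omega>_def n_def)
      have "eventually (\<lambda>r. \<kappa> \<le> bump_mean u x r) (at_right 0)"
        unfolding \<kappa>_def \<omega>_def n_def using U x u0 by (intro bump_mean_ge_near[OF u, of U]) auto
      from exists_large_derivative[OF has_real_derivative_bump_mean[OF uG] this R(1,4) FR \<epsilon>(1) \<kappa>]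
      obtain r where r: "0 < r" "r < R"
        "\<kappa> * \<epsilon> / 4 / r * ln (1 / r) powr (- 1 - \<epsilon>) \<le> \<bar>?F' r\<bar>" by auto
      define A where "A = a / r * ln (1 / r) powr (- 1 - \<epsilon>)"
      have A: "1 \<le> A" unfolding A_def using r R b by auto
      have "1 \<le> ln (1 / r)"
      proof -
        have "ln r \<le> ln (exp (- 1))" using r R by (subst ln_le_cancel_iff) auto
        then show ?thesis using r by (simp add: ln_div)
      qed
      then have "ln (1 / r) powr (- 1 - \<epsilon>) \<le> ln (1 / r) powr 0"
        using \<epsilon> by (intro powr_mono) auto
      then have "a / r * ln (1 / r) powr (- 1 - \<epsilon>) \<le> 1 / r * 1"
        using a r by (intro mult_mono divide_right_mono) (auto split: if_splits)
      then have A': "A \<le> 1 / r" by (simp add: A_def)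
      let ?IG = "\<integral>\<^sup>+y. ennreal (norm (G y)) * indicator (ball x r) y \<partial>lebesgue"
      have big: "ennreal (2 * (A * (unit_ball_vol (DIM('a)) * r ^ DIM('a)))) \<le> ?IG"
      proof -
        have "2 * \<omega> * a \<le> \<kappa> * \<epsilon> / 4" using a(3) \<omega> by (simp add: field_simps)
        then have "2 * \<omega> * a * (ln (1 / r) powr (- 1 - \<epsilon>) / r) \<le>
            \<kappa> * \<epsilon> / 4 * (ln (1 / r) powr (- 1 - \<epsilon>) / r)"
          using r by (intro mult_right_mono) auto
        then have "2 * \<omega> * A \<le> \<bar>?F' r\<bar>"
          using r(3) by (simp add: A_def)
        then have "2 * \<omega> * A * r ^ DIM('a) \<le> r ^ DIM('a) * \<bar>?F' r\<bar>"
          using r(1) by (subst mult.commute) (intro mult_left_mono, auto)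
        then have "ennreal (2 * (A * (unit_ball_vol (DIM('a)) * r ^ DIM('a)))) \<le>
            ennreal (r ^ DIM('a)) * ennreal \<bar>?F' r\<bar>"
          using r(1) unfolding \<omega>_def n_def
          by (subst ennreal_mult'[symmetric]) (auto intro!: ennreal_leI simp: mult_ac)
        also have "\<dots> \<le> ennreal (r ^ DIM('a)) * (ennreal (1 / r ^ DIM('a)) * ?IG)"
          using r(1) by (intro mult_left_mono norm_bump_mean_derivative_le) auto
        also have "\<dots> = ?IG"
          using r(1) by (simp add: mult.assoc[symmetric] ennreal_mult'[symmetric])
        finally show ?thesis .
      qed
      let ?Ip = "\<integral>\<^sup>+y. ennreal (norm (G y) powr p y) * indicator (ball x r) y \<partial>lebesgue"
      have mass: "ennreal (\<omega> * r ^ DIM('a) * A powr p x) \<le> ennreal (exp c) * ?Ip"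
        unfolding \<omega>_def n_def
        by (rule large_mean_imp_large_modular) (use p r R A A' c big in auto)
      have "h x (10 * r) = (10 * r) powr (n - p x) * ln (1 / (10 * r)) powr (- P - \<delta>)"
        unfolding n_def P_def using r R by (intro h) auto
      also have "\<dots> \<le> K * (r powr n * A powr p x)"
        unfolding K_def A_def
        by (rule gauge_le_power) (use r R p[of x] pP[of x] a \<epsilon> in \<open>auto simp: n_def\<close>)
      also have "\<dots> = K / \<omega> * (\<omega> * r ^ DIM('a) * A powr p x)"
        using r \<omega> by (simp add: n_def powr_realpow)
      finally have "ennreal (h x (10 * r)) \<le> ennreal (K / \<omega>) * ennreal (\<omega> * r ^ DIM('a) * A powr p x)"
        using K \<omega> by (subst ennreal_mult'[symmetric]) (auto intro!: ennreal_leI)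
      also have "\<dots> \<le> ennreal (K / \<omega>) * (ennreal (exp c) * ?Ip)"
        by (intro mult_left_mono mass) auto
      also have "\<dots> = ennreal (K / \<omega> * exp c) * ?Ip"
        using K \<omega> by (simp add: mult.assoc[symmetric] ennreal_mult'[symmetric])
      finally show "\<exists>r. 0 < r \<and> 10 * r \<le> \<eta> \<and> ennreal (h x (10 * r)) \<le> ennreal (K / \<omega> * exp c) *
          (\<integral>\<^sup>+y. ennreal (norm (G y) powr p y) * indicator (ball x r) y \<partial>lebesgue)"
        using r R by (intro exI[of _ r]) auto
    qed (use \<eta> in auto)
    also have "\<dots> \<le> ennreal (K / \<omega> * exp c) * ennreal m"
      by (intro mult_left_mono mod_G) auto
    finally show ?thesis
      using K \<omega> m by (simp add: ennreal_mult'[symmetric])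
  qed
  have "hausdorff_pre h \<eta> E \<le> 0"
  proof (rule ennreal_le_epsilon)
    fix e :: real assume e: "0 < e"
    define C where "C = K / \<omega> * exp c"
    have C: "0 < C" using K \<omega> by (simp add: C_def)
    have "hausdorff_pre h \<eta> E \<le> ennreal (C * min m\<^sub>0 (e / C))"
      by (rule main[folded C_def]) (use m\<^sub>0 e C in auto)
    also have "\<dots> \<le> ennreal (C * (e / C))"
      using C by (intro ennreal_leI mult_left_mono) auto
    also have "C * (e / C) = e" using C by simp
    finally show "hausdorff_pre h \<eta> E \<le> 0 + ennreal e" by simp
  qed
  then show ?thesis by simp
qed

theorem theorem1p3:
  fixes p :: "real ^ 'n \<Rightarrow> real"
    and h :: "real ^ 'n \<Rightarrow> real \<Rightarrow> real"
    and \<delta> :: real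
    and E :: "(real ^ 'n) set"
  assumes "CARD('n) \<ge> 2"
    and "\<And>x. 1 \<le> p x \<and> p x \<le> real CARD('n)"
    and "log_Holder_continuous p"
    and "log_Holder_decay p"
    and "\<delta> > 0"
    and "\<And>x t. 0 < t \<Longrightarrow> t < 1 \<Longrightarrow>
           h x t = t powr (real CARD('n) - p x) * ln (1 / t) powr (- exponent_sup p - \<delta>)"
    and "sobolev_capacity p E = 0"
  shows "hausdorff_gauge h E = 0"
proof -
  have "hausdorff_pre h \<eta> E = 0" if "0 < \<eta>" for \<eta>
    using assms that by (intro hausdorff_pre_eq_0_if_capacity_0[of p \<delta>]) auto
  then have "eventually (\<lambda>\<eta>. hausdorff_pre h \<eta> E = 0) (at_right 0)"
    by (auto simp: eventually_at_right_field intro: exI[of _ 1])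
  then show ?thesis
    unfolding hausdorff_gauge_def by (intro tendsto_Lim tendsto_eventually) auto
qed

end
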